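(* Let $p$ be a prime, let $G$ be a finite $p$-group of order $p^n$, and let $a_1,\ldots,a_n$ be Jennings generators for the group algebra $\mathbb{F}_pG$. With respect to the Jennings ordering $\leq_{J}$ on words in $a_1,\ldots,a_n$ the following hold. (1) The minimal tips are exactly the words $a_i^p$ ($1\leq i\leq n$) and $a_j a_k$ ($1\leq j<k\leq n$). (2) The nontips are exactly the words $a_n^{e_n}a_{n-1}^{e_{n-1}}\cdots a_1^{e_1}$ with $0\leq e_i\leq p-1$ for all $i$. (3) For a nontip $w$ and $r\geq 0$, the image of $w$ in $\mathbb{F}_pG$ lies in $J^r(\mathbb{F}_pG)\setminus J^{r+1}(\mathbb{F}_pG)$ if and only if $\dim(w)=r$.
   Context: $J^r(\mathbb{F}_pG)$ denotes the $r$th power of the Jacobson radical of $\mathbb{F}_pG$, with $J^0=\mathbb{F}_pG$. Jennings pc-generators: for $r\geq 1$ let $F_r(G)=\{g\in G\mid g-1\in J^r(\mathbb{F}_pG)\}$ (the $r$th dimension subgroup). The $F_r(G)$ form a descending central series $G=F_1(G)\geq F_2(G)\geq\cdots$ (not necessarily strictly decreasing) that eventually reaches the trivial group. For $|G|=p^n$, elements $g_1,\ldots,g_n$ of $G$ are Jennings pc-generators for $G$ if the first $m_1$ of the $g_i$ lie in $F_1(G)$ and their images are minimal generators for $F_1(G)/F_2(G)$, the next $m_2$ lie in $F_2(G)$ and their images are minimal generators for $F_2(G)/F_3(G)$, and so on. Jennings generators: if $g_1,\ldots,g_n$ are Jennings pc-generators for $G$, then $a_1,\ldots,a_n$ with $a_i=g_i-1$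 are called Jennings generators for $\mathbb{F}_pG$. The generator $a_i$ has dimension $\dim(a_i)=r$ if $a_i\in J^r(\mathbb{F}_pG)\setminus J^{r+1}(\mathbb{F}_pG)$, equivalently $g_i\in F_r(G)\setminus F_{r+1}(G)$. Words: let $M$ be the free monoid (with $1$) on the alphabet $a_1,\ldots,a_n$, ordered by $a_1<a_2<\cdots<a_n$. Write $\ell(w)$ for the length of a word $w$, let $\leq_{\mathrm{lex}}$ be the induced lexicographical ordering, and define $\dim(a_{i_1}\cdots a_{i_r})=\sum_{j=1}^r\dim(a_{i_j})$. Jennings ordering on $M$: $w_1\leq_{J}w_2$ if $\dim(w_1)>\dim(w_2)$; or the dimensions are equal and $\ell(w_1)<\ell(w_2)$; or the dimensions and lengths are equal and $w_1\geq_{\mathrm{lex}}w_2$. Tips: let $I$ be the kernel of the natural surjection from the free associative unital $\mathbb{F}_p$-algebra on the letters $a_1,\ldots,a_n$ onto $\mathbb{F}_pG$. A word $w\in M$ is a tip if it is the largest word (for the given ordering) in the support of some nonzero element of $I$; otherwise it is a nontip. A tip is minimal if all of its proper subwords (i.e. proper contiguous factors) are nontips. *)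

theory Defs
  imports
    "HOL-Algebra.Algebra"
    "HOL-Number_Theory.Residues"
    "HOL-Library.Sublist"
begin

definition supp :: "('r, 'c) ring_scheme \<Rightarrow> ('m, 'd) monoid_scheme \<Rightarrow> ('m \<Rightarrow> 'r) \<Rightarrow> 'm set" where
  "supp R M f = {x \<in> carrier M. f x \<noteq> \<zero>\<^bsub>R\<^esub>}"

text \<open>Elements are finitely supported coefficient functions on \<open>M\<close> (extensional, i.e.
  \<open>undefined\<close> off \<open>carrier M\<close>); the product is convolution.  Group algebras and free
  associative unital algebras are both instances.\<close>

definition monoid_algebra ::
  "('r, 'c) ring_scheme \<Rightarrow> ('m, 'd) monoid_scheme \<Rightarrow> ('r, 'm \<Rightarrow> 'r) module" where
  "monoid_algebra R M =
     \<lparr> carrier = {f \<in> carrier M \<rightarrow>\<^sub>E carrier R. finite (supp R M f)},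
       monoid.mult = (\<lambda>f g. \<lambda>x\<in>carrier M.
          finsum R (\<lambda>(y, z). f y \<otimes>\<^bsub>R\<^esub> g z)
            {(y, z) \<in> supp R M f \<times> supp R M g. y \<otimes>\<^bsub>M\<^esub> z = x}),
       monoid.one = (\<lambda>x\<in>carrier M. if x = \<one>\<^bsub>M\<^esub> then \<one>\<^bsub>R\<^esub> else \<zero>\<^bsub>R\<^esub>),
       ring.zero = (\<lambda>x\<in>carrier M. \<zero>\<^bsub>R\<^esub>),
       ring.add = (\<lambda>f g. \<lambda>x\<in>carrier M. f x \<oplus>\<^bsub>R\<^esub> g x),
       module.smult = (\<lambda>c f. \<lambda>x\<in>carrier M. c \<otimes>\<^bsub>R\<^esub> f x) \<rparr>"

definition basis_elem :: "('r, 'c) ring_scheme \<Rightarrow> ('m, 'd) monoid_scheme \<Rightarrow> 'm \<Rightarrow> ('m \<Rightarrow> 'r)" where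
  "basis_elem R M g = (\<lambda>x\<in>carrier M. if x = g then \<one>\<^bsub>R\<^esub> else \<zero>\<^bsub>R\<^esub>)"

abbreviation prime_field :: "nat \<Rightarrow> int ring" where
  "prime_field p \<equiv> residue_ring (int p)"

definition group_algebra :: "nat \<Rightarrow> ('g, 'd) monoid_scheme \<Rightarrow> (int, 'g \<Rightarrow> int) module" where
  "group_algebra p G = monoid_algebra (prime_field p) G"

definition group_elem :: "nat \<Rightarrow> ('g, 'd) monoid_scheme \<Rightarrow> 'g \<Rightarrow> ('g \<Rightarrow> int)" where
  "group_elem p G g = basis_elem (prime_field p) G g"

definition left_ideal :: "'x set \<Rightarrow> ('x, 'd) ring_scheme \<Rightarrow> bool" where
  "left_ideal I R \<longleftrightarrow> additive_subgroup I R \<and> (\<forall>x\<in>carrier R. \<forall>y\<in>I. x \<otimes>\<^bsub>R\<^esub> y \<in> I)"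

definition maximal_left_ideal :: "'x set \<Rightarrow> ('x, 'd) ring_scheme \<Rightarrow> bool" where
  "maximal_left_ideal I R \<longleftrightarrow> left_ideal I R \<and> I \<noteq> carrier R \<and>
     (\<forall>L. left_ideal L R \<and> I \<subseteq> L \<and> L \<noteq> carrier R \<longrightarrow> L = I)"

definition jacobson_radical :: "('x, 'd) ring_scheme \<Rightarrow> 'x set" where
  "jacobson_radical R = carrier R \<inter> \<Inter>{I. maximal_left_ideal I R}"

fun rad_power :: "('x, 'd) ring_scheme \<Rightarrow> nat \<Rightarrow> 'x set" where
  "rad_power R 0 = carrier R"
| "rad_power R (Suc r) = ideal_prod R (rad_power R r) (jacobson_radical R)"

definition dimension_subgroup :: "nat \<Rightarrow> ('g, 'd) monoid_scheme \<Rightarrow> nat \<Rightarrow> 'g set" where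
  "dimension_subgroup p G r =
     {g \<in> carrier G. group_elem p G g \<ominus>\<^bsub>group_algebra p G\<^esub> \<one>\<^bsub>group_algebra p G\<^esub>
        \<in> rad_power (group_algebra p G) r}"

definition minimal_generating_family ::
  "('h, 'd) monoid_scheme \<Rightarrow> ('i \<Rightarrow> 'h) \<Rightarrow> 'i set \<Rightarrow> bool" where
  "minimal_generating_family H x I \<longleftrightarrow>
     x ` I \<subseteq> carrier H \<and> generate H (x ` I) = carrier H \<and>
     (\<forall>K. K \<subset> I \<longrightarrow> generate H (x ` K) \<noteq> carrier H)"

definition dimension_quotient :: "nat \<Rightarrow> ('g, 'd) monoid_scheme \<Rightarrow> nat \<Rightarrow> 'g set monoid" where
  "dimension_quotient p G r =
     (G\<lparr>carrier := dimension_subgroup p G r\<rparr>) Mod (dimension_subgroup p G (Suc r))"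

text \<open>The \<open>r\<close>th block of consecutive indices (\<open>r \<ge> 1\<close>), when the blocks have sizes
  \<open>m 1, m 2, \<dots>\<close> and indexing starts at 1.\<close>

definition block :: "(nat \<Rightarrow> nat) \<Rightarrow> nat \<Rightarrow> nat set" where
  "block m r = {(\<Sum>k\<in>{1..<r}. m k) <.. (\<Sum>k\<in>{1..r}. m k)}"

text \<open>Only the values \<open>g 1, \<dots>, g n\<close> matter.\<close>

definition jennings_pc_generators ::
  "nat \<Rightarrow> ('g, 'd) monoid_scheme \<Rightarrow> nat \<Rightarrow> (nat \<Rightarrow> 'g) \<Rightarrow> bool" where
  "jennings_pc_generators p G n g \<longleftrightarrow>
     (\<exists>m. {1..n} = (\<Union>r\<in>{1..}. block m r) \<and>
       (\<forall>r\<ge>1. g ` block m r \<subseteq> dimension_subgroup p G r \<and>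
          minimal_generating_family (dimension_quotient p G r)
            (\<lambda>i. dimension_subgroup p G (Suc r) #>\<^bsub>G\<^esub> g i) (block m r)))"

definition jennings_generators ::
  "nat \<Rightarrow> ('g, 'd) monoid_scheme \<Rightarrow> nat \<Rightarrow> (nat \<Rightarrow> 'g \<Rightarrow> int) \<Rightarrow> bool" where
  "jennings_generators p G n a \<longleftrightarrow>
     (\<exists>g. jennings_pc_generators p G n g \<and>
       (\<forall>i\<in>{1..n}. a i = group_elem p G (g i) \<ominus>\<^bsub>group_algebra p G\<^esub> \<one>\<^bsub>group_algebra p G\<^esub>))"

definition rad_dim :: "('x, 'd) ring_scheme \<Rightarrow> 'x \<Rightarrow> nat" where
  "rad_dim A x = (THE r. x \<in> rad_power A r - rad_power A (Suc r))"

text \<open>A word is a list of letter indices: \<open>[i\<^sub>1, \<dots>, i\<^sub>r]\<close> stands for the word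
  \<open>a\<^sub>i\<^sub>1 \<cdots> a\<^sub>i\<^sub>r\<close>, so that \<open>a\<^sub>1 < \<cdots> < a\<^sub>n\<close> is the order of the indices.\<close>

definition words :: "nat \<Rightarrow> nat list set" where
  "words n = lists {1..n}"

definition free_word_monoid :: "nat \<Rightarrow> nat list monoid" where
  "free_word_monoid n = \<lparr> carrier = words n, monoid.mult = (@), monoid.one = [] \<rparr>"

definition word_dim :: "('x, 'd) ring_scheme \<Rightarrow> (nat \<Rightarrow> 'x) \<Rightarrow> nat list \<Rightarrow> nat" where
  "word_dim A a w = (\<Sum>i\<leftarrow>w. rad_dim A (a i))"

definition jennings_le ::
  "('x, 'd) ring_scheme \<Rightarrow> (nat \<Rightarrow> 'x) \<Rightarrow> nat list \<Rightarrow> nat list \<Rightarrow> bool" where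
  "jennings_le A a v w \<longleftrightarrow>
     word_dim A a v > word_dim A a w \<or>
     (word_dim A a v = word_dim A a w \<and> length v < length w) \<or>
     (word_dim A a v = word_dim A a w \<and> length v = length w \<and> ord_class.lexordp_eq w v)"

definition free_algebra :: "nat \<Rightarrow> nat \<Rightarrow> (int, nat list \<Rightarrow> int) module" where
  "free_algebra p n = monoid_algebra (prime_field p) (free_word_monoid n)"

fun word_image :: "('x, 'd) ring_scheme \<Rightarrow> (nat \<Rightarrow> 'x) \<Rightarrow> nat list \<Rightarrow> 'x" where
  "word_image A a [] = \<one>\<^bsub>A\<^esub>"
| "word_image A a (i # w) = a i \<otimes>\<^bsub>A\<^esub> word_image A a w"

definition natural_surjection ::
  "nat \<Rightarrow> ('g, 'd) monoid_scheme \<Rightarrow> nat \<Rightarrow> (nat \<Rightarrow> 'g \<Rightarrow> int) \<Rightarrow> (nat list \<Rightarrow> int) \<Rightarrow> ('g \<Rightarrow> int)" where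
  "natural_surjection p G n a f =
     (\<Oplus>\<^bsub>group_algebra p G\<^esub>w\<in>supp (prime_field p) (free_word_monoid n) f.
        f w \<odot>\<^bsub>group_algebra p G\<^esub> word_image (group_algebra p G) a w)"

definition relation_ideal ::
  "nat \<Rightarrow> ('g, 'd) monoid_scheme \<Rightarrow> nat \<Rightarrow> (nat \<Rightarrow> 'g \<Rightarrow> int) \<Rightarrow> (nat list \<Rightarrow> int) set" where
  "relation_ideal p G n a =
     a_kernel (free_algebra p n) (group_algebra p G) (natural_surjection p G n a)"

definition tip ::
  "nat \<Rightarrow> ('g, 'd) monoid_scheme \<Rightarrow> nat \<Rightarrow> (nat \<Rightarrow> 'g \<Rightarrow> int) \<Rightarrow> nat list \<Rightarrow> bool" where
  "tip p G n a w \<longleftrightarrow>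
     (\<exists>f\<in>relation_ideal p G n a. f \<noteq> \<zero>\<^bsub>free_algebra p n\<^esub> \<and>
        w \<in> supp (prime_field p) (free_word_monoid n) f \<and>
        (\<forall>v\<in>supp (prime_field p) (free_word_monoid n) f. jennings_le (group_algebra p G) a v w))"

definition nontip ::
  "nat \<Rightarrow> ('g, 'd) monoid_scheme \<Rightarrow> nat \<Rightarrow> (nat \<Rightarrow> 'g \<Rightarrow> int) \<Rightarrow> nat list \<Rightarrow> bool" where
  "nontip p G n a w \<longleftrightarrow> w \<in> words n \<and> \<not> tip p G n a w"

definition minimal_tip ::
  "nat \<Rightarrow> ('g, 'd) monoid_scheme \<Rightarrow> nat \<Rightarrow> (nat \<Rightarrow> 'g \<Rightarrow> int) \<Rightarrow> nat list \<Rightarrow> bool" where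
  "minimal_tip p G n a w \<longleftrightarrow>
     tip p G n a w \<and> (\<forall>v. strict_sublist v w \<longrightarrow> nontip p G n a v)"

text \<open>The word \<open>a\<^sub>n\<^bsup>e n\<^esup> \<cdots> a\<^sub>1\<^bsup>e 1\<^esup>\<close>.\<close>

definition descending_word :: "nat \<Rightarrow> (nat \<Rightarrow> nat) \<Rightarrow> nat list" where
  "descending_word n e = concat (map (\<lambda>i. replicate (e i) i) (rev [1..<Suc n]))"

end

theory Submission
  imports Defs
begin

text \<open>
  Write \<open>J\<close> for the radical of the group algebra.  A word \<open>w\<close> is a tip exactly if its image in the
  group algebra is a linear combination of images of smaller words; call such a word reducible
  (tip_iff_reducible).  So the proposition is about linear algebra in the group algebra.

  For a \<open>p\<close>-group in characteristic \<open>p\<close> every nonzero module has a nonzero fixed vector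
  (exists_fixed_vector_modulo).  This makes \<open>J\<close> the augmentation ideal
  (jacobson_eq_augmentation) and makes it nilpotent (radical_nilpotent).  If \<open>h\<close> lies in the
  \<open>r\<close>th dimension subgroup, then modulo \<open>J\<^bsup>r+1\<^esup>\<close> the element \<open>h - 1\<close> is a linear combination of
  letters of dimension \<open>r\<close> (diff_one_leading_part), because \<open>h \<mapsto> h - 1\<close> is additive at
  this level.  In particular \<open>J\<^sup>r\<close> is spanned by the images of the words of dimension at least
  \<open>r\<close> (P_eq_span_words).

  Two families of words are reducible.  For \<open>j < k\<close> the word \<open>a\<^sub>j a\<^sub>k\<close> differs from the smaller
  word \<open>a\<^sub>k a\<^sub>j\<close> by a ring commutator, which comes from a group commutator in the dimension
  subgroup of index \<open>dim a\<^sub>j + dim a\<^sub>k\<close> (reducible_ascending_pair).  The word \<open>a\<^sub>i\<^sup>p\<close> has image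
  \<open>g\<^sub>i\<^sup>p - 1\<close>, and \<open>g\<^sub>i\<^sup>p\<close> lies in the dimension subgroup of index \<open>p dim a\<^sub>i\<close>
  (reducible_power).  In both cases what has to be written in smaller words is \<open>h - 1\<close> for \<open>h\<close> in
  a dimension subgroup: its leading part consists of single letters, which are shorter, and the rest
  has larger dimension.  The order is compatible with multiplication on both sides, so every word
  with a factor of one of these kinds is reducible, and the remaining words are the descending words
  with exponents at most \<open>p - 1\<close>, here called normal.

  Reduction ends because \<open>J\<close> is nilpotent, so the normal words span the group algebra
  (img_in_span_normal).  There are at most \<open>p\<^sup>n = |G|\<close> of them and the group algebra has \<open>p\<^bsup>|G|\<^esup>\<close>
  elements, so they are linearly independent (normal_independent).  Independence shows that no
  normal word is reducible (not_reducible_normal), which is the description of tips and nontips,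
  and that the image of a normal word of dimension \<open>r\<close> stays outside \<open>J\<^bsup>r+1\<^esup>\<close>, which is spanned by
  smaller words (normal_word_exact_power).

  Since the field is the prime field, subspaces are the same as additive subgroups, and the argument
  is carried out in rings with additive spans.
\<close>

(* The infix form of ideal_prod competes with the scalar multiple [k] \<cdot> x. *)
no_notation ideal_prod (infixl \<open>\<cdot>\<index>\<close> 80)

section \<open>Fixed points of p-group actions\<close>

text \<open>Every orbit has \<open>p\<close>-power size, so the orbits that are not singletons contribute a multiple
  of \<open>p\<close> to the size of the set; as \<open>p\<close> divides this size, the number of fixed points is
  divisible by \<open>p\<close> too, and one fixed point forces another.\<close>

lemma p_group_second_fixed_point:
  assumes act: "group_action G E \<phi>" and p: "Factorial_Ring.prime p" and ord: "order G = p ^ n"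
    and fin: "finite E" and dvd: "p dvd card E"
    and x0: "x0 \<in> E" "\<And>g. g \<in> carrier G \<Longrightarrow> \<phi> g x0 = x0"
  shows "\<exists>x\<in>E. x \<noteq> x0 \<and> (\<forall>g\<in>carrier G. \<phi> g x = x)"
proof (rule ccontr)
  assume no: "\<not> (\<exists>x\<in>E. x \<noteq> x0 \<and> (\<forall>g\<in>carrier G. \<phi> g x = x))"
  interpret act: group_action G E \<phi> by (rule act)
  have one: "\<one>\<^bsub>G\<^esub> \<in> carrier G"
    using act.group_hom by (simp add: group_hom_def group_def monoid.one_closed)
  have orb0: "orbit G \<phi> x0 = {x0}"
    using x0(2) one by (force simp: orbit_def)
  have div: "p dvd card B" if B: "B \<in> orbits G E \<phi> - {{x0}}" for B
  proof -
    obtain x where x: "x \<in> E" "B = orbit G \<phi> x" using B unfolding orbits_def by blast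
    have ne: "x \<noteq> x0" using B x orb0 by auto
    then obtain g where g: "g \<in> carrier G" "\<phi> g x \<noteq> x" using no x(1) by blast
    have "card B dvd p ^ n"
      using act.orbit_stabilizer_theorem[OF x(1)] ord x(2) by (metis dvd_triv_left)
    then obtain k where k: "card B = p ^ k" using divides_primepow_nat[OF p] by blast
    have "x \<in> B" "\<phi> g x \<in> B" using act.orbit_refl[OF x(1)] x(2) g(1) by (auto simp: orbit_def)
    hence "card B \<noteq> 1" using g(2) by (auto simp: card_1_singleton_iff)
    hence "k \<noteq> 0" using k by (cases k) auto
    thus ?thesis using k by (simp add: dvd_power)
  qed
  have finO: "finite (orbits G E \<phi>)"
    using fin act.orbits_coverture by (intro finite_UnionD) simp
  have mem: "{x0} \<in> orbits G E \<phi>" using x0(1) orb0 unfolding orbits_def by blast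
  have "card E = (\<Sum>B\<in>orbits G E \<phi>. card B)"
    using act.disjoint_sum[OF fin, of "\<lambda>_. 1::nat"] by simp
  also have "\<dots> = 1 + (\<Sum>B\<in>orbits G E \<phi> - {{x0}}. card B)"
    using sum.remove[OF finO mem, of card] by simp
  finally have card: "card E = 1 + (\<Sum>B\<in>orbits G E \<phi> - {{x0}}. card B)" .
  have "p dvd (\<Sum>B\<in>orbits G E \<phi> - {{x0}}. card B)"
    by (rule dvd_sum) (rule div)
  hence "p dvd 1" using dvd unfolding card by (simp only: dvd_add_left_iff)
  thus False using p by simp
qed


section \<open>Additive spans and powers of the radical\<close>

context ring
begin

text \<open>Over a prime field the linear subspaces of an algebra are exactly its additive
  subgroups, so this is the linear span, stated without scalars.\<close>

definition add_span :: "'a set \<Rightarrow> 'a set" where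
  "add_span S = generate (add_monoid R) S"

lemma additive_subgroup_intro:
  assumes "H \<subseteq> carrier R" "\<zero> \<in> H" "\<And>x y. x \<in> H \<Longrightarrow> y \<in> H \<Longrightarrow> x \<oplus> y \<in> H"
    "\<And>x. x \<in> H \<Longrightarrow> \<ominus> x \<in> H"
  shows "additive_subgroup H R"
  using assms by unfold_locales (auto simp: a_inv_def)

lemma additive_subgroup_minus:
  assumes "additive_subgroup H R" "x \<in> H" "y \<in> H"
  shows "x \<ominus> y \<in> H"
  using assms by (simp add: a_minus_def additive_subgroup.a_closed
      additive_subgroup.a_inv_closed abelian_group_axioms)

lemma additive_subgroup_add_span:
  "S \<subseteq> carrier R \<Longrightarrow> additive_subgroup (add_span S) R"
  unfolding add_span_def by (rule additive_subgroupI) (rule add.generate_is_subgroup)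

lemma add_span_incl: "x \<in> S \<Longrightarrow> x \<in> add_span S"
  unfolding add_span_def by (rule generate.incl)

lemma add_span_in_carrier: "S \<subseteq> carrier R \<Longrightarrow> add_span S \<subseteq> carrier R"
  unfolding add_span_def by (rule add.generate_incl)

lemma zero_in_add_span: "\<zero> \<in> add_span S"
  using generate.one[of "add_monoid R" S] by (simp add: add_span_def)

lemma add_span_mono: "S \<subseteq> T \<Longrightarrow> add_span S \<subseteq> add_span T"
  unfolding add_span_def by (rule add.mono_generate)

lemma add_span_least: "additive_subgroup H R \<Longrightarrow> S \<subseteq> H \<Longrightarrow> add_span S \<subseteq> H"
  unfolding add_span_def by (rule add.generate_subgroup_incl) (auto dest: additive_subgroup.a_subgroup)

lemma add_span_leastD:
  "x \<in> add_span S \<Longrightarrow> additive_subgroup H R \<Longrightarrow> (\<And>s. s \<in> S \<Longrightarrow> s \<in> H) \<Longrightarrow> x \<in> H"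
  using add_span_least[of H S] by blast

lemma add_span_trans: "T \<subseteq> carrier R \<Longrightarrow> S \<subseteq> add_span T \<Longrightarrow> add_span S \<subseteq> add_span T"
  by (rule add_span_least[OF additive_subgroup_add_span])

lemma additive_subgroup_left_preimage:
  assumes "additive_subgroup H R" "x \<in> carrier R"
  shows "additive_subgroup {y \<in> carrier R. x \<otimes> y \<in> H} R"
  using assms by (intro additive_subgroup_intro)
    (auto simp: r_distr r_minus additive_subgroup.zero_closed additive_subgroup.a_closed
      additive_subgroup.a_inv_closed abelian_group_axioms)

lemma additive_subgroup_right_preimage:
  assumes "additive_subgroup H R" "x \<in> carrier R"
  shows "additive_subgroup {y \<in> carrier R. y \<otimes> x \<in> H} R"
  using assms by (intro additive_subgroup_intro)
    (auto simp: l_distr l_minus additive_subgroup.zero_closed additive_subgroup.a_closed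
      additive_subgroup.a_inv_closed abelian_group_axioms)

lemma add_span_lmult:
  assumes "y \<in> add_span S" "S \<subseteq> carrier R" "x \<in> carrier R" "additive_subgroup H R"
    "\<And>s. s \<in> S \<Longrightarrow> x \<otimes> s \<in> H"
  shows "x \<otimes> y \<in> H"
  using add_span_leastD[OF assms(1) additive_subgroup_left_preimage[OF assms(4,3)]] assms by blast

lemma add_span_rmult:
  assumes "y \<in> add_span S" "S \<subseteq> carrier R" "x \<in> carrier R" "additive_subgroup H R"
    "\<And>s. s \<in> S \<Longrightarrow> s \<otimes> x \<in> H"
  shows "y \<otimes> x \<in> H"
  using add_span_leastD[OF assms(1) additive_subgroup_right_preimage[OF assms(4,3)]] assms by blast

lemma add_span_mult:
  assumes "x \<in> add_span S" "y \<in> add_span T" "S \<subseteq> carrier R" "T \<subseteq> carrier R"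
    "additive_subgroup H R" "\<And>s t. s \<in> S \<Longrightarrow> t \<in> T \<Longrightarrow> s \<otimes> t \<in> H"
  shows "x \<otimes> y \<in> H"
proof (rule add_span_rmult[OF assms(1,3) _ assms(5)])
  show "y \<in> carrier R" using assms add_span_in_carrier by blast
  show "s \<otimes> y \<in> H" if "s \<in> S" for s
    using add_span_lmult[OF assms(2,4) _ assms(5)] assms(3,6) that by blast
qed

lemma additive_subgroup_add_pow:
  assumes "additive_subgroup H R" "x \<in> H"
  shows "[(k::int)] \<cdot> x \<in> H"
  using add.subgroup_int_pow_closed[OF additive_subgroup.a_subgroup] assms by simp

lemma additive_subgroup_add_pow_nat:
  assumes "additive_subgroup H R" "x \<in> H"
  shows "[(k::nat)] \<cdot> x \<in> H"
  using additive_subgroup_add_pow[OF assms, of "int k"] by (simp add: add_pow_int_ge)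

text \<open>The counting form of the fact that \<open>m\<close> vectors span a space of dimension at most \<open>m\<close>: each
  further generator \<open>x\<close> multiplies the size by at most \<open>p\<close>, because every multiple of \<open>x\<close>
  is one by \<open>0, \<dots>, p - 1\<close>.  All linear independence below is deduced from this bound.\<close>

lemma card_add_span_le:
  fixes p :: nat
  assumes "finite S" "S \<subseteq> carrier R" "\<And>x. x \<in> S \<Longrightarrow> [p] \<cdot> x = \<zero>" "p > 0"
  shows "finite (add_span S) \<and> card (add_span S) \<le> p ^ card S"
  using assms(1-3)
proof (induction S)
  case empty
  have "additive_subgroup {\<zero>} R" by (rule additive_subgroup_intro) auto
  hence "add_span {} \<subseteq> {\<zero>}" by (rule add_span_least) simp
  thus ?case using card_mono[of "{\<zero>}" "add_span {}"] by (simp add: finite_subset)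
next
  case (insert x S)
  have S: "S \<subseteq> carrier R" and x: "x \<in> carrier R" and px: "[p] \<cdot> x = \<zero>"
    using insert.prems by auto
  note sub = additive_subgroup_add_span[OF S]
  interpret H: additive_subgroup "add_span S" R by (rule sub)
  define f where "f = (\<lambda>(k, y). [(k::nat)] \<cdot> x \<oplus> y)"
  define T where "T = f ` ({..<p} \<times> add_span S)"
  have mem: "[(k::nat)] \<cdot> x \<oplus> y \<in> T" if y: "y \<in> add_span S" for k y
  proof -
    have "[k] \<cdot> x = [(p * (k div p) + k mod p)] \<cdot> x" by simp
    also have "\<dots> = [(p * (k div p))] \<cdot> x \<oplus> [(k mod p)] \<cdot> x"
      by (rule add.nat_pow_mult[OF x, symmetric])
    also have "[(p * (k div p))] \<cdot> x = \<zero>"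
      by (subst add.nat_pow_pow[OF x, symmetric]) (simp add: px)
    finally have "[k] \<cdot> x = [(k mod p)] \<cdot> x" using x by simp
    thus ?thesis unfolding T_def f_def using y assms(4) by (auto intro!: image_eqI[of _ _ "(k mod p, y)"])
  qed
  have neg: "\<ominus> ([k] \<cdot> x) = [((p - 1) * k)] \<cdot> x" for k
  proof -
    have "[((p - 1) * k)] \<cdot> x \<oplus> [k] \<cdot> x = [(p * k)] \<cdot> x"
      using assms(4) by (simp add: add.nat_pow_mult[OF x] algebra_simps flip: mult_Suc)
    also have "\<dots> = \<zero>" by (subst add.nat_pow_pow[OF x, symmetric]) (simp add: px)
    finally show ?thesis using x by (intro minus_equality) auto
  qed
  have "additive_subgroup T R"
  proof (rule additive_subgroup_intro)
    show "T \<subseteq> carrier R" unfolding T_def f_def using x by auto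
    show "\<zero> \<in> T" using mem[of \<zero> 0] by simp
    fix a assume "a \<in> T"
    then obtain k y where a: "a = [(k::nat)] \<cdot> x \<oplus> y" "y \<in> add_span S" by (auto simp: T_def f_def)
    have "\<ominus> a = [((p - 1) * k)] \<cdot> x \<oplus> \<ominus> y" using a x by (simp add: minus_add neg)
    thus "\<ominus> a \<in> T" using mem a(2) by simp
    fix b assume "b \<in> T"
    then obtain l z where b: "b = [(l::nat)] \<cdot> x \<oplus> z" "z \<in> add_span S" by (auto simp: T_def f_def)
    have "a \<oplus> b = [(k + l)] \<cdot> x \<oplus> (y \<oplus> z)"
      using a b x by (simp add: add.nat_pow_mult[symmetric] a_ac)
    thus "a \<oplus> b \<in> T" using mem a(2) b(2) by simp
  qed
  moreover have "insert x S \<subseteq> T"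
    using mem[of \<zero> 1] mem[of _ 0] x S by (auto intro: add_span_incl)
  ultimately have sub: "add_span (insert x S) \<subseteq> T" by (rule add_span_least)
  have IH: "finite (add_span S)" "card (add_span S) \<le> p ^ card S" using insert by auto
  hence fT: "finite T" by (simp add: T_def)
  have "card (add_span (insert x S)) \<le> card T" by (rule card_mono[OF fT sub])
  also have "\<dots> \<le> card ({..<p} \<times> add_span S)" unfolding T_def using IH by (intro card_image_le) simp
  also have "\<dots> \<le> p ^ card (insert x S)" using IH insert.hyps by (simp add: card_cartesian_product)
  finally show ?case using finite_subset[OF sub fT] by blast
qed

lemma finsum_in_additive_subgroup:
  assumes "additive_subgroup H R" "finite A" "\<And>i. i \<in> A \<Longrightarrow> f i \<in> H"
  shows "(\<Oplus>i\<in>A. f i) \<in> H"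
  using assms(2,3)
proof (induction A)
  case empty
  then show ?case using assms(1) by (simp add: additive_subgroup.zero_closed)
next
  case (insert i A)
  have "f \<in> insert i A \<rightarrow> carrier R"
    using insert.prems additive_subgroup.a_Hcarr[OF assms(1)] by auto
  then show ?case using insert assms(1) by (simp add: Pi_def additive_subgroup.a_closed)
qed

text \<open>The ring need not be commutative, but \<open>1\<close> and \<open>x\<close> commute, which is all that Pascal's rule uses.\<close>

lemma binomial_expansion:
  assumes x: "x \<in> carrier R"
  shows "(\<one> \<oplus> x) [^] (m::nat) = (\<Oplus>k\<in>{..m}. [(m choose k)] \<cdot> (x [^] k))"
proof (induction m)
  case 0
  then show ?case using x by simp
next
  case (Suc m)
  let ?t = "\<lambda>m k. [(m choose k::nat)] \<cdot> (x [^] (k::nat))"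
  have c: "?t m k \<in> carrier R" for m k using x by simp
  have "(\<one> \<oplus> x) [^] Suc m = (\<Oplus>k\<in>{..m}. ?t m k) \<otimes> (\<one> \<oplus> x)" using Suc x by simp
  also have "\<dots> = (\<Oplus>k\<in>{..m}. ?t m k) \<oplus> (\<Oplus>k\<in>{..m}. ?t m k) \<otimes> x"
    using x c by (simp add: r_distr finsum_closed Pi_def)
  also have "(\<Oplus>k\<in>{..m}. ?t m k) \<otimes> x = (\<Oplus>k\<in>{..m}. [(m choose k)] \<cdot> (x [^] Suc k))"
    using x c by (subst finsum_ldistr) (auto simp: add_pow_ldistr intro!: finsum_cong')
  also have "(\<Oplus>k\<in>{..m}. ?t m k) = (\<Oplus>k\<in>{..Suc m}. ?t m k)"
    using x by (simp add: finsum_Suc Pi_def finsum_closed binomial_eq_0)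
  also have "\<dots> = (\<Oplus>k\<in>{..m}. ?t m (Suc k)) \<oplus> \<one>"
    using x by (subst finsum_Suc2) auto
  also have "\<dots> \<oplus> (\<Oplus>k\<in>{..m}. [(m choose k)] \<cdot> (x [^] Suc k))
    = (\<Oplus>k\<in>{..m}. ?t m (Suc k)) \<oplus> (\<Oplus>k\<in>{..m}. [(m choose k)] \<cdot> (x [^] Suc k)) \<oplus> \<one>"
    using x by (simp add: a_ac finsum_closed Pi_def)
  also have "(\<Oplus>k\<in>{..m}. ?t m (Suc k)) \<oplus> (\<Oplus>k\<in>{..m}. [(m choose k)] \<cdot> (x [^] Suc k))
      = (\<Oplus>k\<in>{..m}. ?t m (Suc k) \<oplus> [(m choose k)] \<cdot> (x [^] Suc k))"
    using x by (subst finsum_addf) (auto simp: Pi_def)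
  also have "\<dots> = (\<Oplus>k\<in>{..m}. ?t (Suc m) (Suc k))"
    using x by (intro finsum_cong') (auto simp: add.nat_pow_mult a_comm add.commute)
  also have "\<dots> \<oplus> \<one> = (\<Oplus>k\<in>{..Suc m}. ?t (Suc m) k)"
    using x by (subst finsum_Suc2) auto
  finally show ?case .
qed

lemma frobenius_one_plus:
  fixes p :: nat
  assumes x: "x \<in> carrier R" and p: "Factorial_Ring.prime p"
    and char: "\<And>y. y \<in> carrier R \<Longrightarrow> [p] \<cdot> y = \<zero>"
  shows "(\<one> \<oplus> x) [^] p = \<one> \<oplus> x [^] p"
proof -
  let ?t = "\<lambda>k. [(p choose k::nat)] \<cdot> (x [^] (k::nat))"
  obtain q where q: "p = Suc q" using p by (metis not0_implies_Suc not_prime_0)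
  have z: "?t k = \<zero>" if k: "0 < k" "k < p" for k
  proof -
    obtain c where "p choose k = p * c" using dvd_choose_prime[of k p] k p by (auto elim: dvdE)
    hence "?t k = [c] \<cdot> ([p] \<cdot> (x [^] k))" using x by (simp add: add.nat_pow_pow mult.commute)
    thus ?thesis using x char by simp
  qed
  have "(\<one> \<oplus> x) [^] p = (\<Oplus>k\<in>{..p}. ?t k)" by (rule binomial_expansion[OF x])
  also have "\<dots> = (\<Oplus>k\<in>{0, p}. ?t k)"
    using x q z by (intro add.finprod_mono_neutral_cong_right) auto
  also have "\<dots> = \<one> \<oplus> x [^] p" using x q by simp
  finally show ?thesis .
qed

lemma ideal_prod_least:
  assumes "additive_subgroup H R" "\<And>i j. i \<in> I \<Longrightarrow> j \<in> J \<Longrightarrow> i \<otimes> j \<in> H"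
  shows "ideal_prod R I J \<subseteq> H"
proof
  fix x assume "x \<in> ideal_prod R I J"
  thus "x \<in> H"
    by induction (use assms in \<open>auto intro: additive_subgroup.a_closed\<close>)
qed

context
  assumes J_ideal: "ideal (jacobson_radical R) R"
begin

lemma rad_power_ideal: "ideal (rad_power R r) R"
  by (induction r) (use J_ideal in \<open>auto intro: oneideal ideal_prod_is_ideal\<close>)

lemma rad_power_subgroup: "additive_subgroup (rad_power R r) R"
  using rad_power_ideal by (rule ideal.axioms(1))

lemma rad_power_carrier: "x \<in> rad_power R r \<Longrightarrow> x \<in> carrier R"
  by (rule ideal.Icarr[OF rad_power_ideal])

lemma rad_power_Suc_subset: "rad_power R (Suc r) \<subseteq> rad_power R r"
  using ideal_prod_inter[OF rad_power_ideal[of r] J_ideal] by simp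

lemma rad_power_antimono: "r \<le> s \<Longrightarrow> rad_power R s \<subseteq> rad_power R r"
  by (induction s rule: dec_induct) (use rad_power_Suc_subset in blast)+

lemma rad_power_1: "rad_power R (Suc 0) = jacobson_radical R"
proof
  show "rad_power R (Suc 0) \<subseteq> jacobson_radical R"
    using ideal_prod_inter[OF oneideal J_ideal] by simp
  show "jacobson_radical R \<subseteq> rad_power R (Suc 0)"
  proof
    fix x assume x: "x \<in> jacobson_radical R"
    hence "\<one> \<otimes> x \<in> rad_power R (Suc 0)"
      unfolding rad_power.simps by (intro ideal_prod.prod) auto
    thus "x \<in> rad_power R (Suc 0)" using ideal.Icarr[OF J_ideal x] by simp
  qed
qed

lemma rad_power_mult:
  "x \<in> rad_power R r \<Longrightarrow> y \<in> rad_power R s \<Longrightarrow> x \<otimes> y \<in> rad_power R (r + s)"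
proof (induction s arbitrary: x y)
  case 0
  then show ?case using ideal.I_r_closed[OF rad_power_ideal] by simp
next
  case (Suc s)
  note x = rad_power_carrier[OF Suc.prems(1)]
  have "rad_power R (Suc s) \<subseteq> {y \<in> carrier R. x \<otimes> y \<in> rad_power R (r + Suc s)}"
    unfolding rad_power.simps(2)[of R s]
  proof (rule ideal_prod_least)
    show "additive_subgroup {y \<in> carrier R. x \<otimes> y \<in> rad_power R (r + Suc s)} R"
      by (rule additive_subgroup_left_preimage[OF rad_power_subgroup x])
    fix i j assume i: "i \<in> rad_power R s" and j: "j \<in> jacobson_radical R"
    have c: "i \<in> carrier R" "j \<in> carrier R"
      using i j rad_power_carrier ideal.Icarr[OF J_ideal] by auto
    have "(x \<otimes> i) \<otimes> j \<in> rad_power R (r + Suc s)"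
      using Suc.IH[OF Suc.prems(1) i] j by (simp add: ideal_prod.prod)
    thus "i \<otimes> j \<in> {y \<in> carrier R. x \<otimes> y \<in> rad_power R (r + Suc s)}"
      using c x by (simp add: m_assoc)
  qed
  thus ?case using Suc.prems(2) by blast
qed

lemma rad_power_pow: "x \<in> rad_power R r \<Longrightarrow> x [^] (k::nat) \<in> rad_power R (r * k)"
proof (induction k)
  case (Suc k)
  then show ?case using rad_power_mult[OF Suc.IH[OF Suc.prems] Suc.prems] by (simp add: add.commute)
qed simp

lemma rad_dim_eqI:
  assumes "x \<in> rad_power R r" "x \<notin> rad_power R (Suc r)"
  shows "rad_dim R x = r"
  unfolding rad_dim_def
proof (rule the_equality)
  show "x \<in> rad_power R r - rad_power R (Suc r)" using assms by simp
  fix s assume s: "x \<in> rad_power R s - rad_power R (Suc s)"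
  show "s = r"
  proof (rule linorder_cases[of s r])
    assume "s < r" thus ?thesis using rad_power_antimono[of "Suc s" r] assms s by auto
  next
    assume "r < s" thus ?thesis using rad_power_antimono[of "Suc r" s] assms s by auto
  qed
qed

end

end

section \<open>The augmentation ideal is the nilpotent radical\<close>

text \<open>The group algebra of a \<open>p\<close>-group \<open>G\<close> over the field of \<open>p\<close> elements, described abstractly:
  the elements \<open>u g\<close> multiply as in \<open>G\<close> and span the ring, the characteristic is \<open>p\<close>, and the
  number of elements is that of a space of dimension \<open>|G|\<close>, so that the \<open>u g\<close> form a basis.\<close>

locale p_group_algebra = ring R + G: group G
  for R :: "('a, 'b) ring_scheme" (structure) and G :: "('g, 'c) monoid_scheme" +
  fixes p n :: nat and u :: "'g \<Rightarrow> 'a"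
  assumes prime_p: "Factorial_Ring.prime p"
    and finite_G: "finite (carrier G)"
    and order_G: "order G = p ^ n"
    and card_R: "card (carrier R) = p ^ p ^ n"
    and u_closed [simp, intro]: "g \<in> carrier G \<Longrightarrow> u g \<in> carrier R"
    and u_mult: "g \<in> carrier G \<Longrightarrow> h \<in> carrier G \<Longrightarrow> u (g \<otimes>\<^bsub>G\<^esub> h) = u g \<otimes> u h"
    and u_one: "u \<one>\<^bsub>G\<^esub> = \<one>"
    and u_span: "carrier R \<subseteq> add_span (u ` carrier G)"
    and char_p: "x \<in> carrier R \<Longrightarrow> [p] \<cdot> x = \<zero>"
begin

lemma finite_R: "finite (carrier R)"
  using card_R prime_p by (metis card_ge_0_finite prime_gt_0_nat zero_less_power)

lemma u_inv_cancel:
  assumes "g \<in> carrier G" "x \<in> carrier R"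
  shows "u (inv\<^bsub>G\<^esub> g) \<otimes> (u g \<otimes> x) = x" "u g \<otimes> (u (inv\<^bsub>G\<^esub> g) \<otimes> x) = x"
  using assms by (simp_all add: u_one flip: m_assoc u_mult)

lemma char_p_int_dvd:
  assumes "x \<in> carrier R" "int p dvd k"
  shows "[k] \<cdot> x = \<zero>"
proof -
  obtain l where l: "k = int p * l" using assms(2) by blast
  have "[k] \<cdot> x = [l] \<cdot> ([int p] \<cdot> x)"
    unfolding l using add.int_pow_pow[OF assms(1), of l "int p"] by simp
  also have "[int p] \<cdot> x = \<zero>" using char_p[OF assms(1)] by (simp add: add_pow_int_ge)
  finally show ?thesis by simp
qed

lemma add_pow_mod:
  assumes "x \<in> carrier R"
  shows "[(k mod int p)] \<cdot> x = [k] \<cdot> x"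
proof -
  have "[k] \<cdot> x = [(k mod int p)] \<cdot> x \<oplus> [(k - k mod int p)] \<cdot> x"
    using add.int_pow_mult[OF assms, of "k mod int p" "k - k mod int p"] by simp
  also have "[(k - k mod int p)] \<cdot> x = \<zero>"
    by (rule char_p_int_dvd[OF assms]) (simp add: dvd_minus_mod)
  finally show ?thesis using assms by simp
qed

lemma in_additive_subgroup_if_multiple:
  assumes H: "additive_subgroup H R" and x: "x \<in> carrier R"
    and k: "\<not> int p dvd k" "[k] \<cdot> x \<in> H"
  shows "x \<in> H"
proof -
  have "coprime (int p) k" using prime_p k(1) by (intro prime_imp_coprime) auto
  hence "coprime k (int p)" by (simp add: coprime_commute)
  then obtain a b where ab: "a * k + b * int p = 1"
    using bezout_int[of k "int p"] by (auto simp: coprime_iff_gcd_eq_1)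
  have "[a] \<cdot> ([k] \<cdot> x) \<in> H" by (rule additive_subgroup_add_pow[OF H k(2)])
  also have "[a] \<cdot> ([k] \<cdot> x) = [(1 - b * int p)] \<cdot> x"
    using add.int_pow_pow[OF x, of a k] ab by (simp add: mult.commute flip: ab)
  also have "\<dots> = [(1::int)] \<cdot> x"
    using add_pow_mod[OF x, of "1 - b * int p"] add_pow_mod[OF x, of 1]
    by (simp add: mod_diff_right_eq[symmetric])
  also have "\<dots> = x" using x by (simp add: add_pow_int_ge)
  finally show ?thesis .
qed

text \<open>\<open>G\<close> acts on the cosets of \<open>L\<close>, whose number is a power of \<open>p\<close> greater than \<open>1\<close>, and \<open>L\<close>
  itself is a fixed coset.  The second fixed coset gives the element \<open>x\<close>.  This is the statement
  that a nonzero module over a \<open>p\<close>-group in characteristic \<open>p\<close> has a nonzero fixed vector.\<close>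

lemma exists_fixed_vector_modulo:
  assumes L: "additive_subgroup L R" and ne: "L \<noteq> carrier R"
    and stable: "\<And>g x. g \<in> carrier G \<Longrightarrow> x \<in> L \<Longrightarrow> u g \<otimes> x \<in> L"
  shows "\<exists>x\<in>carrier R - L. \<forall>g\<in>carrier G. u g \<otimes> x \<ominus> x \<in> L"
proof -
  interpret L: abelian_subgroup L R
    by (rule abelian_subgroupI3[OF L abelian_group_axioms])
  define \<phi> where "\<phi> = (\<lambda>g. \<lambda>C\<in>a_rcosets L. (\<lambda>x. u g \<otimes> x) ` C)"
  have \<phi>: "\<phi> g (L +> x) = L +> (u g \<otimes> x)" if g: "g \<in> carrier G" and x: "x \<in> carrier R" for g x
  proof -
    have "(\<lambda>y. u g \<otimes> y) ` (L +> x) = L +> (u g \<otimes> x)"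
    proof (intro equalityI subsetI)
      fix y assume "y \<in> (\<lambda>y. u g \<otimes> y) ` (L +> x)"
      then obtain l where "l \<in> L" "y = u g \<otimes> (l \<oplus> x)" by (auto simp: a_r_coset_def')
      thus "y \<in> L +> (u g \<otimes> x)"
        using g x stable[OF g] L.a_Hcarr by (auto simp: a_r_coset_def' r_distr)
    next
      fix y assume "y \<in> L +> (u g \<otimes> x)"
      then obtain l where l: "l \<in> L" "y = l \<oplus> (u g \<otimes> x)" by (auto simp: a_r_coset_def')
      have "y = u g \<otimes> (u (inv\<^bsub>G\<^esub> g) \<otimes> l \<oplus> x)"
        using g x l by (simp add: r_distr u_inv_cancel)
      moreover have "u (inv\<^bsub>G\<^esub> g) \<otimes> l \<oplus> x \<in> L +> x"
        using g l stable by (auto simp: a_r_coset_def')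
      ultimately show "y \<in> (\<lambda>y. u g \<otimes> y) ` (L +> x)" by (rule image_eqI)
    qed
    thus ?thesis using x by (simp add: \<phi>_def a_rcosetsI L.a_subset)
  qed
  have cosetE: "\<exists>x\<in>carrier R. C = L +> x" if "C \<in> a_rcosets L" for C
    using that by (auto simp: A_RCOSETS_def')
  have cosetI: "L +> x \<in> a_rcosets L" if "x \<in> carrier R" for x
    using that L.a_subset by (rule_tac a_rcosetsI)
  have \<phi>_closed: "\<phi> g C \<in> a_rcosets L" if "g \<in> carrier G" "C \<in> a_rcosets L" for g C
    using that cosetE[OF that(2)] \<phi> cosetI by auto
  have \<phi>_mult: "\<phi> (g \<otimes>\<^bsub>G\<^esub> h) C = \<phi> g (\<phi> h C)"
    if "g \<in> carrier G" "h \<in> carrier G" "C \<in> a_rcosets L" for g h C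
    using that cosetE[OF that(3)] \<phi> by (auto simp: u_mult m_assoc)
  have \<phi>_one: "\<phi> \<one>\<^bsub>G\<^esub> C = C" if "C \<in> a_rcosets L" for C
    using that cosetE[OF that] \<phi> by (auto simp: u_one)
  have bij: "\<phi> g \<in> Bij (a_rcosets L)" if g: "g \<in> carrier G" for g
  proof -
    have "bij_betw (\<phi> g) (a_rcosets L) (a_rcosets L)"
      by (rule bij_betw_byWitness[where f' = "\<phi> (inv\<^bsub>G\<^esub> g)"])
        (use g \<phi>_closed \<phi>_one in \<open>auto simp flip: \<phi>_mult\<close>)
    thus ?thesis by (auto simp: Bij_def \<phi>_def)
  qed
  have act: "group_action G (a_rcosets L) \<phi>"
  proof (intro group_action.intro group_hom.intro group_hom_axioms.intro)
    show "group G" by (rule G.group_axioms)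
    show "group (BijGroup (a_rcosets L))" by (rule group_BijGroup)
    show "\<phi> \<in> hom G (BijGroup (a_rcosets L))"
    proof (rule homI)
      fix g h assume gh: "g \<in> carrier G" "h \<in> carrier G"
      have "\<phi> (g \<otimes>\<^bsub>G\<^esub> h) = compose (a_rcosets L) (\<phi> g) (\<phi> h)"
      proof (rule extensionalityI[of _ "a_rcosets L"])
        show "\<phi> (g \<otimes>\<^bsub>G\<^esub> h) \<in> extensional (a_rcosets L)" by (simp add: \<phi>_def)
        show "compose (a_rcosets L) (\<phi> g) (\<phi> h) \<in> extensional (a_rcosets L)" by simp
        show "\<phi> (g \<otimes>\<^bsub>G\<^esub> h) C = compose (a_rcosets L) (\<phi> g) (\<phi> h) C" if "C \<in> a_rcosets L" for C
          using that gh by (simp add: \<phi>_mult compose_eq)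
      qed
      thus "\<phi> (g \<otimes>\<^bsub>G\<^esub> h) = \<phi> g \<otimes>\<^bsub>BijGroup (a_rcosets L)\<^esub> \<phi> h"
        using gh bij by (simp add: BijGroup_def)
    qed (use bij in \<open>simp add: BijGroup_def\<close>)
  qed
  have card: "card (a_rcosets L) * card L = p ^ p ^ n"
    using a_lagrange[OF finite_R L] card_R by (simp add: order_def)
  have "card (a_rcosets L) \<noteq> 1"
  proof
    assume "card (a_rcosets L) = 1"
    hence "card L = card (carrier R)" using card card_R by simp
    thus False using ne card_subset_eq[OF finite_R L.a_subset] by simp
  qed
  moreover obtain k where k: "card (a_rcosets L) = p ^ k"
    using divides_primepow_nat[OF prime_p] card by (metis dvd_triv_left)
  ultimately have "k \<noteq> 0" by (cases k) auto
  hence dvd: "p dvd card (a_rcosets L)" using k by (simp add: dvd_power)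
  have finE: "finite (a_rcosets L)"
    using finite_R by (simp add: A_RCOSETS_def')
  have L0: "L +> \<zero> = L" using L.a_subset by (auto simp: a_r_coset_def')
  have Lfix: "\<phi> g L = L" if "g \<in> carrier G" for g
    using \<phi>[OF that, of \<zero>] that by (simp add: L0)
  have "L \<in> a_rcosets L" using cosetI[of \<zero>] by (simp add: L0)
  from p_group_second_fixed_point[OF act prime_p order_G finE dvd this Lfix]
  obtain C where C: "C \<in> a_rcosets L" "C \<noteq> L" "\<And>g. g \<in> carrier G \<Longrightarrow> \<phi> g C = C" by auto
  obtain x where x: "x \<in> carrier R" "C = L +> x" using cosetE[OF C(1)] by auto
  have "x \<notin> L" using C(2) x L.a_rcos_const by auto
  moreover have "u g \<otimes> x \<ominus> x \<in> L" if g: "g \<in> carrier G" for g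
  proof -
    have "L +> (u g \<otimes> x) = L +> x" using C(3)[OF g] \<phi>[OF g x(1)] x(2) by simp
    moreover have "u g \<otimes> x \<in> L +> (u g \<otimes> x)"
      using g x(1) L.zero_closed by (force simp: a_r_coset_def')
    ultimately obtain l where "l \<in> L" "u g \<otimes> x = l \<oplus> x" by (auto simp: a_r_coset_def')
    thus ?thesis using x(1) L.a_Hcarr by (simp add: a_minus_def a_assoc r_neg)
  qed
  ultimately show ?thesis using x(1) by blast
qed

definition diff_one :: "'g \<Rightarrow> 'a" where
  "diff_one g = u g \<ominus> \<one>"

lemma diff_one_closed [simp, intro]: "g \<in> carrier G \<Longrightarrow> diff_one g \<in> carrier R"
  by (simp add: diff_one_def)

lemma u_eq_diff_one: "g \<in> carrier G \<Longrightarrow> u g = \<one> \<oplus> diff_one g"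
  by (simp add: diff_one_def a_minus_def a_lcomm[of \<one>] r_neg)

lemma diff_one_left:
  assumes "h \<in> carrier G" "g \<in> carrier G"
  shows "u h \<otimes> diff_one g = diff_one (h \<otimes>\<^bsub>G\<^esub> g) \<ominus> diff_one h"
  using assms
  by (simp add: diff_one_def u_mult a_minus_def r_distr r_minus minus_add minus_minus a_assoc)
    (simp add: a_lcomm[of "\<ominus> \<one>"] l_neg)

lemma diff_one_right:
  assumes "h \<in> carrier G" "g \<in> carrier G"
  shows "diff_one g \<otimes> u h = diff_one (g \<otimes>\<^bsub>G\<^esub> h) \<ominus> diff_one h"
  using assms
  by (simp add: diff_one_def u_mult a_minus_def l_distr l_minus minus_add minus_minus a_assoc)
    (simp add: a_lcomm[of "\<ominus> \<one>"] l_neg)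

definition augmentation_ideal :: "'a set" where
  "augmentation_ideal = add_span (diff_one ` carrier G)"

lemma diff_one_subset: "diff_one ` carrier G \<subseteq> carrier R"
  by auto

lemma u_subset: "u ` carrier G \<subseteq> carrier R"
  by auto

lemma augmentation_subgroup: "additive_subgroup augmentation_ideal R"
  unfolding augmentation_ideal_def by (rule additive_subgroup_add_span[OF diff_one_subset])

lemma diff_one_in_augmentation: "g \<in> carrier G \<Longrightarrow> diff_one g \<in> augmentation_ideal"
  unfolding augmentation_ideal_def by (auto intro: add_span_incl)

lemma augmentation_is_ideal: "ideal augmentation_ideal R"
proof (rule idealI)
  show "ring R" by (rule ring_axioms)
  show "subgroup augmentation_ideal (add_monoid R)"
    using augmentation_subgroup by (rule additive_subgroup.a_subgroup)
  note D = additive_subgroup_minus[OF augmentation_subgroup diff_one_in_augmentation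
      diff_one_in_augmentation]
  fix a x assume a: "a \<in> augmentation_ideal" and x: "x \<in> carrier R"
  have xs: "x \<in> add_span (u ` carrier G)" using x u_span by blast
  show "x \<otimes> a \<in> augmentation_ideal"
    by (rule add_span_mult[OF xs a[unfolded augmentation_ideal_def] u_subset diff_one_subset
          augmentation_subgroup]) (auto simp: diff_one_left intro!: D)
  show "a \<otimes> x \<in> augmentation_ideal"
    by (rule add_span_mult[OF a[unfolded augmentation_ideal_def] xs diff_one_subset u_subset
          augmentation_subgroup]) (auto simp: diff_one_right intro!: D)
qed

lemma minus_add_cancel_pow:
  assumes "x \<in> carrier R" "y \<in> carrier R" "z \<in> carrier R"
  shows "(x \<oplus> y) \<ominus> [(k + l :: int)] \<cdot> z = (x \<ominus> [k] \<cdot> z) \<oplus> (y \<ominus> [l] \<cdot> z)"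
  using assms by (simp add: a_minus_def minus_add a_ac add.int_pow_mult)

text \<open>The subgroup \<open>L + \<int>z\<close>.\<close>

lemma additive_subgroup_extend:
  assumes L: "additive_subgroup L R" and z: "z \<in> carrier R"
  shows "additive_subgroup {x \<in> carrier R. \<exists>k::int. x \<ominus> [k] \<cdot> z \<in> L} R"
proof (rule additive_subgroup_intro)
  interpret L: additive_subgroup L R by (rule L)
  show "\<zero> \<in> {x \<in> carrier R. \<exists>k::int. x \<ominus> [k] \<cdot> z \<in> L}"
    by (auto intro!: exI[of _ 0] simp: a_minus_def add_pow_int_ge)
  fix x assume "x \<in> {x \<in> carrier R. \<exists>k::int. x \<ominus> [k] \<cdot> z \<in> L}"
  then obtain k :: int where x: "x \<in> carrier R" "x \<ominus> [k] \<cdot> z \<in> L" by auto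
  have "\<ominus> x \<ominus> [(- k)] \<cdot> z = \<ominus> (x \<ominus> [k] \<cdot> z)"
    using x z add.int_pow_neg[OF z, of k] by (simp add: a_minus_def minus_add minus_minus)
  hence "\<ominus> x \<ominus> [(- k)] \<cdot> z \<in> L" using x(2) by simp
  thus "\<ominus> x \<in> {x \<in> carrier R. \<exists>k::int. x \<ominus> [k] \<cdot> z \<in> L}" using x by blast
  fix y assume "y \<in> {x \<in> carrier R. \<exists>k::int. x \<ominus> [k] \<cdot> z \<in> L}"
  then obtain l :: int where y: "y \<in> carrier R" "y \<ominus> [l] \<cdot> z \<in> L" by auto
  have "(x \<oplus> y) \<ominus> [(k + l)] \<cdot> z \<in> L"
    using x y z by (simp only: minus_add_cancel_pow) (auto)
  thus "x \<oplus> y \<in> {x \<in> carrier R. \<exists>k::int. x \<ominus> [k] \<cdot> z \<in> L}" using x y by blast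
qed auto

lemma integer_mod_augmentation:
  assumes "x \<in> carrier R"
  shows "\<exists>k::int. x \<ominus> [k] \<cdot> \<one> \<in> augmentation_ideal"
proof -
  have "x \<in> {x \<in> carrier R. \<exists>k::int. x \<ominus> [k] \<cdot> \<one> \<in> augmentation_ideal}"
  proof (rule add_span_leastD)
    show "x \<in> add_span (u ` carrier G)" using assms u_span by blast
    show "additive_subgroup {x \<in> carrier R. \<exists>k::int. x \<ominus> [k] \<cdot> \<one> \<in> augmentation_ideal} R"
      by (rule additive_subgroup_extend[OF augmentation_subgroup]) simp
    fix s assume "s \<in> u ` carrier G"
    then obtain g where g: "g \<in> carrier G" "s = u g" by blast
    have "s \<ominus> [(1::int)] \<cdot> \<one> \<in> augmentation_ideal"
      using diff_one_in_augmentation[OF g(1)] g(2) by (simp add: diff_one_def add_pow_int_ge)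
    thus "s \<in> {x \<in> carrier R. \<exists>k::int. x \<ominus> [k] \<cdot> \<one> \<in> augmentation_ideal}" using g by blast
  qed
  thus ?thesis by blast
qed

text \<open>By size: one of the \<open>p\<^sup>n\<close> generators \<open>u g - 1\<close> is
  zero, so the ideal has at most \<open>p\<^bsup>p^n - 1\<^esup>\<close> elements.\<close>

lemma augmentation_proper: "augmentation_ideal \<noteq> carrier R"
proof
  let ?S = "diff_one ` (carrier G - {\<one>\<^bsub>G\<^esub>})"
  assume eq: "augmentation_ideal = carrier R"
  have S: "?S \<subseteq> carrier R" by auto
  have z: "diff_one \<one>\<^bsub>G\<^esub> = \<zero>" by (simp add: diff_one_def u_one a_minus_def r_neg)
  have "diff_one ` carrier G \<subseteq> add_span ?S"
  proof (rule image_subsetI)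
    fix g assume "g \<in> carrier G"
    thus "diff_one g \<in> add_span ?S"
      using z zero_in_add_span[of ?S] add_span_incl[of "diff_one g" ?S]
      by (cases "g = \<one>\<^bsub>G\<^esub>") auto
  qed
  hence "augmentation_ideal \<subseteq> add_span ?S"
    unfolding augmentation_ideal_def using S by (intro add_span_trans)
  moreover have fin: "finite ?S" using finite_G by simp
  note c = card_add_span_le[OF fin S char_p prime_gt_0_nat[OF prime_p]]
  ultimately have "card (carrier R) \<le> p ^ card ?S"
    unfolding eq using c S card_mono[of "add_span ?S" "carrier R"] by (auto intro: order.trans)
  also have "\<dots> \<le> p ^ (p ^ n - 1)"
  proof (rule power_increasing)
    have "card ?S \<le> card (carrier G - {\<one>\<^bsub>G\<^esub>})" using finite_G by (intro card_image_le) simp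
    thus "card ?S \<le> p ^ n - 1" using order_G by (simp add: order_def)
  qed (use prime_gt_0_nat[OF prime_p] in simp)
  also have "\<dots> < p ^ p ^ n"
    using prime_gt_1_nat[OF prime_p] by (intro power_strict_increasing) simp_all
  finally show False using card_R by simp
qed

lemma left_ideal_eq_carrier:
  assumes "left_ideal L R" "\<one> \<in> L"
  shows "L = carrier R"
proof
  show "L \<subseteq> carrier R" using assms(1) unfolding left_ideal_def by (auto dest: additive_subgroup.a_Hcarr)
  show "carrier R \<subseteq> L"
  proof
    fix x assume "x \<in> carrier R"
    hence "x \<otimes> \<one> \<in> L" using assms unfolding left_ideal_def by blast
    thus "x \<in> L" using \<open>x \<in> carrier R\<close> by simp
  qed
qed

text \<open>Modulo the augmentation ideal every element is an integer multiple of \<open>1\<close>, hence a left ideal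
  that is strictly larger contains a multiple of \<open>1\<close> by an integer prime to \<open>p\<close>.\<close>

lemma augmentation_maximal: "maximal_left_ideal augmentation_ideal R"
  unfolding maximal_left_ideal_def
proof (intro conjI allI impI)
  show "left_ideal augmentation_ideal R"
    unfolding left_ideal_def using augmentation_subgroup ideal.I_l_closed[OF augmentation_is_ideal] by blast
  show "augmentation_ideal \<noteq> carrier R" by (rule augmentation_proper)
  fix L assume "left_ideal L R \<and> augmentation_ideal \<subseteq> L \<and> L \<noteq> carrier R"
  hence L: "left_ideal L R" "augmentation_ideal \<subseteq> L" "L \<noteq> carrier R" by auto
  have sub: "additive_subgroup L R" using L(1) by (simp add: left_ideal_def)
  show "L = augmentation_ideal"
  proof (rule ccontr)
    assume "L \<noteq> augmentation_ideal"
    then obtain x where x: "x \<in> L" "x \<notin> augmentation_ideal" using L by blast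
    have xc: "x \<in> carrier R" by (rule additive_subgroup.a_Hcarr[OF sub x(1)])
    obtain k :: int where k: "x \<ominus> [k] \<cdot> \<one> \<in> augmentation_ideal"
      using integer_mod_augmentation[OF xc] by blast
    have "\<not> int p dvd k"
    proof
      assume "int p dvd k"
      hence "[k] \<cdot> \<one> = \<zero>" by (intro char_p_int_dvd) auto
      thus False using k x(2) xc by (simp add: a_minus_def)
    qed
    moreover have "x \<ominus> (x \<ominus> [k] \<cdot> \<one>) \<in> L"
      using k L(2) x(1) by (blast intro: additive_subgroup_minus[OF sub])
    hence "[k] \<cdot> \<one> \<in> L" using xc by (simp add: a_minus_def minus_add minus_minus r_neg2)
    ultimately have "\<one> \<in> L" by (intro in_additive_subgroup_if_multiple[OF sub one_closed])
    thus False using left_ideal_eq_carrier[OF L(1)] L(3) by blast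
  qed
qed

lemma augmentation_mult_fixed:
  assumes L: "additive_subgroup L R" and x: "x \<in> carrier R"
    and fixed: "\<And>g. g \<in> carrier G \<Longrightarrow> u g \<otimes> x \<ominus> x \<in> L" and d: "d \<in> augmentation_ideal"
  shows "d \<otimes> x \<in> L"
  by (rule add_span_rmult[OF d[unfolded augmentation_ideal_def] diff_one_subset x L])
    (use fixed x in \<open>auto simp: diff_one_def a_minus_def l_distr l_minus\<close>)

text \<open>The simple module belonging to \<open>L\<close> has a nonzero fixed vector, represented by \<open>x\<close>.  As
  \<open>L + \<int>x\<close> is again a left ideal, it is everything by maximality, so that the simple module
  is spanned by a fixed vector and is killed by the augmentation ideal.\<close>

lemma augmentation_subset_maximal:
  assumes L: "maximal_left_ideal L R"
  shows "augmentation_ideal \<subseteq> L"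
proof
  have LL: "left_ideal L R" and ne: "L \<noteq> carrier R"
    and max: "\<And>M. left_ideal M R \<Longrightarrow> L \<subseteq> M \<Longrightarrow> M \<noteq> carrier R \<Longrightarrow> M = L"
    using L unfolding maximal_left_ideal_def by blast+
  have sub: "additive_subgroup L R" and mult: "\<And>x y. x \<in> carrier R \<Longrightarrow> y \<in> L \<Longrightarrow> x \<otimes> y \<in> L"
    using LL unfolding left_ideal_def by auto
  obtain x where x: "x \<in> carrier R" "x \<notin> L" "\<And>g. g \<in> carrier G \<Longrightarrow> u g \<otimes> x \<ominus> x \<in> L"
    using exists_fixed_vector_modulo[OF sub ne] mult by blast
  have dx: "d \<otimes> x \<in> L" if "d \<in> augmentation_ideal" for d
    using augmentation_mult_fixed[OF sub x(1) _ that] x(3) by blast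
  \<comment> \<open>The left ideal generated by \<open>L\<close> and \<open>x\<close>.\<close>
  define M where "M = {y \<in> carrier R. \<exists>k::int. y \<ominus> [k] \<cdot> x \<in> L}"
  have subM: "additive_subgroup M R"
    unfolding M_def by (rule additive_subgroup_extend[OF sub x(1)])
  have "left_ideal M R"
    unfolding left_ideal_def
  proof (intro conjI ballI subM)
    fix r y assume r: "r \<in> carrier R" and y: "y \<in> M"
    then obtain k :: int where k: "y \<in> carrier R" "y \<ominus> [k] \<cdot> x \<in> L" by (auto simp: M_def)
    obtain l :: int where l: "r \<ominus> [l] \<cdot> \<one> \<in> augmentation_ideal"
      using integer_mod_augmentation[OF r] by blast
    \<comment> \<open>With \<open>d = r - l\<close> in the augmentation ideal, \<open>r y - k l x = r (y - k x) + k d x\<close>.\<close>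
    have "r \<otimes> (y \<ominus> [k] \<cdot> x) \<oplus> [k] \<cdot> ((r \<ominus> [l] \<cdot> \<one>) \<otimes> x) \<in> L"
      using mult[OF r k(2)] additive_subgroup_add_pow[OF sub dx[OF l]] sub
      by (auto intro: additive_subgroup.a_closed)
    also have "r \<otimes> (y \<ominus> [k] \<cdot> x) \<oplus> [k] \<cdot> ((r \<ominus> [l] \<cdot> \<one>) \<otimes> x) = r \<otimes> y \<ominus> [(l * k)] \<cdot> x"
    proof -
      have "[k] \<cdot> ((r \<ominus> [l] \<cdot> \<one>) \<otimes> x) = [k] \<cdot> (r \<otimes> x) \<oplus> \<ominus> ([k] \<cdot> ([l] \<cdot> x))"
        using r x(1) by (simp add: a_minus_def l_distr l_minus add_pow_ldistr_int
            add.int_pow_distrib add.int_pow_inv)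
      moreover have "r \<otimes> (y \<ominus> [k] \<cdot> x) = r \<otimes> y \<oplus> \<ominus> ([k] \<cdot> (r \<otimes> x))"
        using r x(1) k(1) by (simp add: a_minus_def r_distr r_minus add_pow_rdistr_int)
      ultimately show ?thesis
        using r x(1) k(1) by (simp add: a_minus_def a_assoc r_neg1 add.int_pow_pow)
    qed
    finally show "r \<otimes> y \<in> M" using r k(1) by (auto simp: M_def)
  qed
  moreover have "L \<subseteq> M"
    using additive_subgroup.a_Hcarr[OF sub] unfolding M_def by (auto intro!: exI[of _ 0] simp: a_minus_def add_pow_int_ge)
  moreover have "x \<in> M"
    using x(1) additive_subgroup.zero_closed[OF sub] unfolding M_def
    by (auto intro!: exI[of _ 1] simp: add_pow_int_ge r_neg a_minus_def)
  ultimately have "M = carrier R" using max[of M] x(2) by blast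
  then obtain k :: int where k: "\<one> \<ominus> [k] \<cdot> x \<in> L" unfolding M_def by blast
  fix d assume d: "d \<in> augmentation_ideal"
  have dc: "d \<in> carrier R" by (rule additive_subgroup.a_Hcarr[OF augmentation_subgroup d])
  have "d \<otimes> (\<one> \<ominus> [k] \<cdot> x) \<oplus> [k] \<cdot> (d \<otimes> x) \<in> L"
    using mult[OF dc k] additive_subgroup_add_pow[OF sub dx[OF d]] sub
    by (auto intro: additive_subgroup.a_closed)
  also have "d \<otimes> (\<one> \<ominus> [k] \<cdot> x) \<oplus> [k] \<cdot> (d \<otimes> x) = d"
    using dc x(1) by (simp add: a_minus_def r_distr r_minus add_pow_rdistr_int a_assoc l_neg)
  finally show "d \<in> L" .
qed

lemma jacobson_eq_augmentation: "jacobson_radical R = augmentation_ideal"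
  unfolding jacobson_radical_def
  using augmentation_maximal augmentation_subset_maximal additive_subgroup.a_subset[OF augmentation_subgroup] by blast

lemma jacobson_ideal: "ideal (jacobson_radical R) R"
  unfolding jacobson_eq_augmentation by (rule augmentation_is_ideal)

abbreviation "P \<equiv> rad_power R"

lemmas P_ideal = rad_power_ideal[OF jacobson_ideal]
lemmas P_subgroup = rad_power_subgroup[OF jacobson_ideal]
lemmas P_carrier = rad_power_carrier[OF jacobson_ideal]
lemmas P_Suc_subset = rad_power_Suc_subset[OF jacobson_ideal]
lemmas P_antimono = rad_power_antimono[OF jacobson_ideal]
lemmas P_mult = rad_power_mult[OF jacobson_ideal]
lemmas P_pow = rad_power_pow[OF jacobson_ideal]
lemmas P_rad_dim = rad_dim_eqI[OF jacobson_ideal]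
lemmas P_lmult = ideal.I_l_closed[OF P_ideal]
lemmas P_rmult = ideal.I_r_closed[OF P_ideal]

lemma P_1: "P (Suc 0) = augmentation_ideal"
  using rad_power_1[OF jacobson_ideal] by (simp add: jacobson_eq_augmentation)

text \<open>The annihilators \<open>K\<^sub>i = {x | J\<^sup>i x = 0}\<close> are left ideals.  As long as \<open>K\<^sub>i\<close> is proper,
  a vector outside \<open>K\<^sub>i\<close> that is fixed modulo \<open>K\<^sub>i\<close> lies in \<open>K\<^bsub>i+1\<^esub>\<close>, so the \<open>K\<^sub>i\<close> grow
  strictly until one of them contains \<open>1\<close>.\<close>

lemma radical_nilpotent: "\<exists>N. P N = {\<zero>}"
proof -
  define K where "K = (\<lambda>i. {x \<in> carrier R. \<forall>y\<in>P i. y \<otimes> x = \<zero>})"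
  have subK: "additive_subgroup (K i) R" for i
    by (rule additive_subgroup_intro) (auto simp: K_def r_distr r_minus P_carrier)
  have stab: "u g \<otimes> x \<in> K i" if "g \<in> carrier G" "x \<in> K i" for g x i
    using that P_rmult[of _ i "u g"] by (auto simp: K_def P_carrier simp flip: m_assoc)
  have mono: "K i \<subseteq> K (Suc i)" for i
    using P_Suc_subset[of i] by (auto simp: K_def)
  have strict: "K i \<subset> K (Suc i)" if ne: "K i \<noteq> carrier R" for i
  proof -
    obtain x where x: "x \<in> carrier R" "x \<notin> K i" "\<And>g. g \<in> carrier G \<Longrightarrow> u g \<otimes> x \<ominus> x \<in> K i"
      using exists_fixed_vector_modulo[OF subK ne stab] by blast
    have "P (Suc i) \<subseteq> {y \<in> carrier R. y \<otimes> x \<in> {\<zero>}}"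
      unfolding rad_power.simps
    proof (rule ideal_prod_least)
      show "additive_subgroup {y \<in> carrier R. y \<otimes> x \<in> {\<zero>}} R"
        by (rule additive_subgroup_right_preimage[OF _ x(1)], rule additive_subgroup_intro) auto
      fix y d assume y: "y \<in> P i" and d: "d \<in> jacobson_radical R"
      have dx: "d \<otimes> x \<in> K i"
        using augmentation_mult_fixed[OF subK x(1)] x(3) d by (simp add: jacobson_eq_augmentation)
      have c: "y \<in> carrier R" "d \<in> carrier R" using P_carrier[OF y] ideal.Icarr[OF jacobson_ideal d] .
      have "y \<otimes> (d \<otimes> x) = \<zero>" using dx y by (simp add: K_def)
      thus "y \<otimes> d \<in> {y \<in> carrier R. y \<otimes> x \<in> {\<zero>}}" using c x(1) by (simp add: m_assoc)
    qed
    hence "x \<in> K (Suc i)" using x(1) by (auto simp: K_def)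
    thus ?thesis using mono x(2) by blast
  qed
  have grow: "K i = carrier R \<or> i \<le> card (K i)" for i
  proof (induction i)
    case (Suc i)
    have fin: "finite (K (Suc i))" using finite_R by (simp add: K_def)
    show ?case
    proof (cases "K i = carrier R")
      case True
      thus ?thesis using mono[of i] by (auto simp: K_def)
    next
      case False
      thus ?thesis using Suc psubset_card_mono[OF fin strict] by fastforce
    qed
  qed simp
  \<comment> \<open>One more than the number of elements, so that strict growth up to here is impossible.\<close>
  define N where "N = Suc (card (carrier R))"
  have "card (K N) \<le> card (carrier R)" using finite_R by (intro card_mono) (auto simp: K_def)
  hence "K N = carrier R" using grow[of N] by (auto simp: N_def)
  hence "\<one> \<in> K N" by simp
  hence "y = \<zero>" if "y \<in> P N" for y
    using that P_carrier[OF that] by (auto simp: K_def)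
  moreover have "\<zero> \<in> P N" using additive_subgroup.zero_closed[OF P_subgroup] .
  ultimately show ?thesis by blast
qed

end

section \<open>Descending words and the Jennings order\<close>

lemma descending_word_0 [simp]: "descending_word 0 e = []"
  by (simp add: descending_word_def)

lemma descending_word_Suc [simp]:
  "descending_word (Suc n) e = replicate (e (Suc n)) (Suc n) @ descending_word n e"
  by (simp add: descending_word_def)

lemma set_descending_word: "set (descending_word n e) \<subseteq> {1..n}"
  by (induction n) auto

lemma descending_word_in_words: "descending_word n e \<in> words n"
  using set_descending_word by (auto simp: words_def)

lemma sorted_descending_word: "sorted_wrt (\<ge>) (descending_word n e)"
proof (induction n)
  case (Suc n)
  have "sorted_wrt (\<ge>) (replicate k (Suc n))" for k by (induction k) auto
  thus ?case using Suc set_descending_word[of n e] by (force simp: sorted_wrt_append)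
qed simp

lemma count_list_replicate: "count_list (replicate k x) y = (if x = y then k else 0)"
  by (induction k) auto

lemma count_list_descending_word:
  "count_list (descending_word n e) i = (if i \<in> {1..n} then e i else 0)"
  by (induction n) (auto simp: count_list_replicate)

lemma descending_word_cong:
  "(\<And>i. i \<in> {1..n} \<Longrightarrow> e i = e' i) \<Longrightarrow> descending_word n e = descending_word n e'"
  by (induction n) auto

lemma sublist_replicate_descending_word:
  "i \<in> {1..n} \<Longrightarrow> sublist (replicate (e i) i) (descending_word n e)"
proof (induction n)
  case (Suc n)
  show ?case
  proof (cases "i = Suc n")
    case False
    hence "sublist (replicate (e i) i) (descending_word n e)" using Suc by auto
    thus ?thesis by (auto simp: sublist_append)
  qed auto
qed simp

lemma sublist_ConsI: "sublist v w \<Longrightarrow> sublist v (x # w)"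
  by (simp add: sublist_Cons_right)

lemma sorted_wrt_if_no_ascending_factor:
  fixes w :: "'a::linorder list"
  assumes "\<And>j k. j < k \<Longrightarrow> \<not> sublist [j, k] w"
  shows "sorted_wrt (\<ge>) w"
  using assms
proof (induction w rule: induct_list012)
  case (3 x y zs)
  have "sorted_wrt (\<ge>) (y # zs)"
    using 3 by (meson sublist_ConsI)
  moreover have "y \<le> x"
    by (rule leI) (use 3(3)[of x y] in \<open>auto simp: sublist_Cons_right\<close>)
  ultimately show ?case by auto
qed auto

lemma sorted_eq_descending_word:
  assumes w: "w \<in> words n" and s: "sorted_wrt (\<ge>) w"
  shows "w = descending_word n (count_list w)"
proof -
  let ?v = "descending_word n (count_list w)"
  have "count_list w i = count_list ?v i" for i
    using w by (auto simp: count_list_descending_word words_def count_list_0_iff)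
  hence m: "mset (rev w) = mset (rev ?v)"
    by (simp add: multiset_eq_iff count_mset)
  have "sorted (rev w)" "sorted (rev ?v)"
    using s sorted_descending_word by (simp_all add: sorted_wrt_rev)
  hence "rev w = rev ?v"
    using m by (metis properties_for_sort)
  thus ?thesis by simp
qed

text \<open>A word without an ascending pair of adjacent letters is weakly descending, hence a product of
  blocks of equal letters; if no block has length \<open>p\<close> or more, the exponents are at most
  \<open>p - 1\<close>.\<close>

lemma normal_word_or_bad_factor:
  assumes w: "w \<in> words n" and p: "p > 0"
  shows "(\<exists>e. (\<forall>i\<in>{1..n}. e i \<le> p - 1) \<and> w = descending_word n e)
    \<or> (\<exists>i\<in>{1..n}. sublist (replicate p i) w)
    \<or> (\<exists>j k. 1 \<le> j \<and> j < k \<and> k \<le> n \<and> sublist [j, k] w)"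
proof (cases "\<exists>j k. j < k \<and> sublist [j, k] w")
  case True
  then obtain j k where jk: "j < k" "sublist [j, k] w" by blast
  hence "{j, k} \<subseteq> {1..n}" using set_mono_sublist[OF jk(2)] w by (auto simp: words_def)
  thus ?thesis using jk by auto
next
  case False
  hence w_eq: "w = descending_word n (count_list w)"
    by (intro sorted_eq_descending_word[OF w] sorted_wrt_if_no_ascending_factor) blast
  show ?thesis
  proof (cases "\<forall>i\<in>{1..n}. count_list w i \<le> p - 1")
    case True
    thus ?thesis using w_eq by blast
  next
    case False
    then obtain i where i: "i \<in> {1..n}" "p \<le> count_list w i" by auto
    have "replicate (count_list w i) i = replicate p i @ replicate (count_list w i - p) i"
      using i(2) by (simp flip: replicate_add)
    hence "sublist (replicate p i) (replicate (count_list w i) i)" by simp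
    moreover have "sublist (replicate (count_list w i) i) w"
      using sublist_replicate_descending_word[OF i(1), of "count_list w"] w_eq by simp
    ultimately show ?thesis using i(1) sublist_order.order_trans by blast
  qed
qed

definition normal_words :: "nat \<Rightarrow> nat \<Rightarrow> nat list set" where
  "normal_words p n = {descending_word n e | e. \<forall>i\<in>{1..n}. e i \<le> p - 1}"

lemma normal_words_subset: "normal_words p n \<subseteq> words n"
  using descending_word_in_words by (auto simp: normal_words_def)

lemma normal_words_finite_card:
  assumes "p > 0"
  shows "finite (normal_words p n) \<and> card (normal_words p n) \<le> p ^ n"
proof -
  have sub: "normal_words p n \<subseteq> descending_word n ` ({1..n} \<rightarrow>\<^sub>E {..p - 1})"
  proof
    fix w assume "w \<in> normal_words p n"
    then obtain e where e: "\<forall>i\<in>{1..n}. e i \<le> p - 1" "w = descending_word n e"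
      by (auto simp: normal_words_def)
    have "w = descending_word n (restrict e {1..n})"
      unfolding e(2) by (rule descending_word_cong) auto
    moreover have "restrict e {1..n} \<in> {1..n} \<rightarrow>\<^sub>E {..p - 1}" using e(1) by auto
    ultimately show "w \<in> descending_word n ` ({1..n} \<rightarrow>\<^sub>E {..p - 1})" by blast
  qed
  have fin: "finite ({1..n} \<rightarrow>\<^sub>E {..p - 1})" by (simp add: finite_PiE)
  have "card (normal_words p n) \<le> card (descending_word n ` ({1..n} \<rightarrow>\<^sub>E {..p - 1}))"
    using fin sub by (intro card_mono) auto
  also have "\<dots> \<le> card ({1..n} \<rightarrow>\<^sub>E {..p - 1})" by (rule card_image_le[OF fin])
  also have "\<dots> = p ^ n" using assms by (simp add: card_PiE)
  finally show ?thesis using finite_subset[OF sub] fin by blast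
qed

lemma normal_word_if_no_bad_factor:
  assumes "w \<in> words n" "p > 0" "\<And>i. i \<in> {1..n} \<Longrightarrow> \<not> sublist (replicate p i) w"
    "\<And>j k. 1 \<le> j \<Longrightarrow> j < k \<Longrightarrow> k \<le> n \<Longrightarrow> \<not> sublist [j, k] w"
  shows "w \<in> normal_words p n"
  using normal_word_or_bad_factor[OF assms(1,2)] assms(3,4) unfolding normal_words_def by blast

definition jennings_less ::
  "('x, 'd) ring_scheme \<Rightarrow> (nat \<Rightarrow> 'x) \<Rightarrow> nat list \<Rightarrow> nat list \<Rightarrow> bool" where
  "jennings_less A a v w \<longleftrightarrow>
     word_dim A a v > word_dim A a w \<or>
     (word_dim A a v = word_dim A a w \<and> length v < length w) \<or>
     (word_dim A a v = word_dim A a w \<and> length v = length w \<and> ord_class.lexordp w v)"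

lemma jennings_le_iff_less_or_eq: "jennings_le A a v w \<longleftrightarrow> jennings_less A a v w \<or> v = w"
  by (auto simp: jennings_le_def jennings_less_def lexordp_eq_conv_lexord)

lemma jennings_less_irrefl: "\<not> jennings_less A a w w"
  by (auto simp: jennings_less_def lexordp_irreflexive')

lemma jennings_less_trans:
  "jennings_less A a u v \<Longrightarrow> jennings_less A a v w \<Longrightarrow> jennings_less A a u w"
  unfolding jennings_less_def using lexordp_trans[of w v u] by auto

lemma word_dim_append [simp]: "word_dim A a (v @ w) = word_dim A a v + word_dim A a w"
  by (simp add: word_dim_def)

text \<open>Equal length excludes the case of a proper prefix, in which appending on the right could
  reverse the order.\<close>

lemma lexordp_append_same_length:
  assumes "ord_class.lexordp (v::'a::linorder list) w" "length v = length w"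
  shows "ord_class.lexordp (x @ v @ y) (x @ w @ z)"
proof -
  obtain us a b vs ws where "a < b" "v = us @ a # vs" "w = us @ b # ws"
    using assms unfolding lexordp_iff by auto
  thus ?thesis using lexordp_append_left_rightI[of a b "x @ us" "vs @ y" "ws @ z"] by simp
qed

lemma jennings_less_context:
  assumes "jennings_less A a v w"
  shows "jennings_less A a (x @ v @ y) (x @ w @ y)"
  using assms lexordp_append_same_length[of w v x y y] unfolding jennings_less_def by auto

lemma words_append [simp]: "v @ w \<in> words n \<longleftrightarrow> v \<in> words n \<and> w \<in> words n"
  by (simp add: words_def)

lemma words_Cons [simp]: "i # w \<in> words n \<longleftrightarrow> i \<in> {1..n} \<and> w \<in> words n"
  by (auto simp: words_def)

lemma words_Nil [simp]: "[] \<in> words n"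
  by (simp add: words_def)

lemma words_replicate: "i \<in> {1..n} \<Longrightarrow> replicate k i \<in> words n"
  by (auto simp: words_def)

section \<open>Dimension subgroups\<close>

(* From here on the powers of the radical are handled through their multiplicative properties. *)
declare rad_power.simps(2) [simp del]

context p_group_algebra
begin

definition dim_subgroup :: "nat \<Rightarrow> 'g set" where
  "dim_subgroup r = {g \<in> carrier G. diff_one g \<in> P r}"

lemma dim_subgroup_carrier: "g \<in> dim_subgroup r \<Longrightarrow> g \<in> carrier G"
  by (simp add: dim_subgroup_def)

lemma dim_subgroupD: "g \<in> dim_subgroup r \<Longrightarrow> diff_one g \<in> P r"
  by (simp add: dim_subgroup_def)

lemma dim_subgroupI: "g \<in> carrier G \<Longrightarrow> diff_one g \<in> P r \<Longrightarrow> g \<in> dim_subgroup r"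
  by (simp add: dim_subgroup_def)

lemma dim_subgroup_Suc_subset: "dim_subgroup (Suc r) \<subseteq> dim_subgroup r"
  using P_Suc_subset by (auto simp: dim_subgroup_def)

lemmas P_add = additive_subgroup.a_closed[OF P_subgroup]
lemmas P_neg = additive_subgroup.a_inv_closed[OF P_subgroup]
lemmas P_minus = additive_subgroup_minus[OF P_subgroup]
lemmas P_zero = additive_subgroup.zero_closed[OF P_subgroup]

lemma diff_one_one: "diff_one \<one>\<^bsub>G\<^esub> = \<zero>"
  by (simp add: diff_one_def u_one a_minus_def r_neg)

lemma diff_one_mult:
  assumes "g \<in> carrier G" "h \<in> carrier G"
  shows "diff_one (g \<otimes>\<^bsub>G\<^esub> h) = diff_one g \<otimes> diff_one h \<oplus> (diff_one g \<oplus> diff_one h)"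
proof -
  define x y where "x = diff_one g" and "y = diff_one h"
  have c: "x \<in> carrier R" "y \<in> carrier R" using assms by (auto simp: x_def y_def)
  have "u (g \<otimes>\<^bsub>G\<^esub> h) = (\<one> \<oplus> x) \<otimes> (\<one> \<oplus> y)"
    by (simp only: u_mult[OF assms] u_eq_diff_one[OF assms(1)] u_eq_diff_one[OF assms(2)] x_def y_def)
  also have "\<dots> = (x \<otimes> y \<oplus> (x \<oplus> y)) \<oplus> \<one>"
    using c by (simp add: l_distr r_distr a_ac)
  finally show ?thesis using c by (simp add: diff_one_def[of "g \<otimes>\<^bsub>G\<^esub> h"] a_minus_def a_assoc r_neg x_def y_def)
qed

lemma diff_one_inv:
  assumes "g \<in> carrier G"
  shows "diff_one (inv\<^bsub>G\<^esub> g) = \<ominus> (u (inv\<^bsub>G\<^esub> g) \<otimes> diff_one g)"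
  using assms diff_one_left[of "inv\<^bsub>G\<^esub> g" g]
  by (simp add: diff_one_one a_minus_def minus_minus)

lemma diff_one_conj:
  assumes "g \<in> carrier G" "h \<in> carrier G"
  shows "diff_one (h \<otimes>\<^bsub>G\<^esub> g \<otimes>\<^bsub>G\<^esub> inv\<^bsub>G\<^esub> h) = u h \<otimes> diff_one g \<otimes> u (inv\<^bsub>G\<^esub> h)"
proof -
  have "u h \<otimes> u (inv\<^bsub>G\<^esub> h) = \<one>" using assms(2) by (simp add: u_one flip: u_mult)
  thus ?thesis using assms
    by (simp add: diff_one_def u_mult a_minus_def l_distr r_distr l_minus r_minus)
qed

lemma dim_subgroup_is_subgroup: "subgroup (dim_subgroup r) G"
proof (rule G.subgroupI)
  show "dim_subgroup r \<noteq> {}"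
    using P_zero by (auto simp: dim_subgroup_def diff_one_one intro!: exI[of _ "\<one>\<^bsub>G\<^esub>"])
qed (auto simp: dim_subgroup_def diff_one_inv diff_one_mult intro!: P_neg P_lmult P_add)

lemma dim_subgroup_normal: "dim_subgroup r \<lhd> G"
  by (rule G.normal_invI[OF dim_subgroup_is_subgroup])
    (auto simp: dim_subgroup_def diff_one_conj intro!: P_rmult[OF P_lmult])

lemma u_pow: "g \<in> carrier G \<Longrightarrow> u (g [^]\<^bsub>G\<^esub> (k::nat)) = u g [^] k"
  by (induction k) (auto simp: u_one u_mult)

text \<open>In characteristic \<open>p\<close> only the outer terms of the binomial expansion of \<open>(1 + (g - 1))\<^sup>p\<close>
  survive.\<close>

lemma diff_one_pow_p:
  assumes "g \<in> carrier G"
  shows "diff_one (g [^]\<^bsub>G\<^esub> p) = diff_one g [^] p"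
proof -
  have "u (g [^]\<^bsub>G\<^esub> p) = \<one> \<oplus> diff_one g [^] p"
    using frobenius_one_plus[OF diff_one_closed[OF assms] prime_p char_p]
    by (simp only: u_pow[OF assms] u_eq_diff_one[OF assms])
  thus ?thesis using assms
    by (simp add: diff_one_def[of "g [^]\<^bsub>G\<^esub> p"] a_minus_def a_comm[of \<one>] a_assoc r_neg)
qed

lemma pow_p_in_dim_subgroup: "g \<in> dim_subgroup r \<Longrightarrow> g [^]\<^bsub>G\<^esub> p \<in> dim_subgroup (r * p)"
  using P_pow by (auto simp: dim_subgroup_def diff_one_pow_p)

text \<open>The ring commutator of \<open>g - 1\<close> and \<open>h - 1\<close> equals \<open>gh - hg = hg (c - 1)\<close>, where \<open>c\<close> is a group
  commutator; this is the reason for the choice of \<open>c\<close>.\<close>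

lemma diff_one_commutator:
  assumes g: "g \<in> carrier G" and h: "h \<in> carrier G"
  shows "diff_one g \<otimes> diff_one h \<ominus> diff_one h \<otimes> diff_one g
    = u (h \<otimes>\<^bsub>G\<^esub> g) \<otimes> diff_one (inv\<^bsub>G\<^esub> (h \<otimes>\<^bsub>G\<^esub> g) \<otimes>\<^bsub>G\<^esub> (g \<otimes>\<^bsub>G\<^esub> h))"
proof -
  define x y where "x = diff_one g" and "y = diff_one h"
  have c: "x \<in> carrier R" "y \<in> carrier R" using assms by (auto simp: x_def y_def)
  have "u (h \<otimes>\<^bsub>G\<^esub> g) \<otimes> diff_one (inv\<^bsub>G\<^esub> (h \<otimes>\<^bsub>G\<^esub> g) \<otimes>\<^bsub>G\<^esub> (g \<otimes>\<^bsub>G\<^esub> h))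
      = diff_one (g \<otimes>\<^bsub>G\<^esub> h) \<ominus> diff_one (h \<otimes>\<^bsub>G\<^esub> g)"
    using g h by (subst diff_one_left) (auto simp: G.inv_solve_left' simp flip: G.m_assoc)
  also have "\<dots> = (x \<otimes> y \<oplus> (x \<oplus> y)) \<ominus> (y \<otimes> x \<oplus> (y \<oplus> x))"
    using g h by (simp add: diff_one_mult x_def y_def)
  also have "\<dots> = x \<otimes> y \<ominus> y \<otimes> x"
  proof -
    have "\<And>A B C. A \<in> carrier R \<Longrightarrow> B \<in> carrier R \<Longrightarrow> C \<in> carrier R \<Longrightarrow>
      (A \<oplus> C) \<ominus> (B \<oplus> C) = A \<ominus> B"
      by (simp add: a_minus_def minus_add a_ac r_neg2 r_neg1 r_neg l_neg)
    from this[of "x \<otimes> y" "y \<otimes> x" "x \<oplus> y"] show ?thesis using c by (simp add: a_comm)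
  qed
  finally show ?thesis by (simp add: x_def y_def)
qed

lemma commutator_in_dim_subgroup:
  assumes g: "g \<in> dim_subgroup r" and h: "h \<in> dim_subgroup s"
  shows "inv\<^bsub>G\<^esub> (h \<otimes>\<^bsub>G\<^esub> g) \<otimes>\<^bsub>G\<^esub> (g \<otimes>\<^bsub>G\<^esub> h) \<in> dim_subgroup (r + s)"
proof (rule dim_subgroupI)
  note c = dim_subgroup_carrier[OF g] dim_subgroup_carrier[OF h]
  let ?c = "inv\<^bsub>G\<^esub> (h \<otimes>\<^bsub>G\<^esub> g) \<otimes>\<^bsub>G\<^esub> (g \<otimes>\<^bsub>G\<^esub> h)"
  show "?c \<in> carrier G" using c by simp
  have hg: "diff_one h \<otimes> diff_one g \<in> P (r + s)"
    using P_mult[OF dim_subgroupD[OF h] dim_subgroupD[OF g]] by (simp add: add.commute)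
  have "u (h \<otimes>\<^bsub>G\<^esub> g) \<otimes> diff_one ?c \<in> P (r + s)"
    using P_minus[OF P_mult[OF dim_subgroupD[OF g] dim_subgroupD[OF h]] hg]
    by (simp add: diff_one_commutator[OF c])
  hence "u (inv\<^bsub>G\<^esub> (h \<otimes>\<^bsub>G\<^esub> g)) \<otimes> (u (h \<otimes>\<^bsub>G\<^esub> g) \<otimes> diff_one ?c) \<in> P (r + s)"
    by (rule P_lmult) (rule u_closed[OF G.inv_closed[OF G.m_closed[OF c(2,1)]]])
  thus "diff_one ?c \<in> P (r + s)"
    using u_inv_cancel(1)[OF G.m_closed[OF c(2,1)] diff_one_closed[OF \<open>?c \<in> carrier G\<close>]]
    by (simp only:)
qed

text \<open>As \<open>u (hg) - 1\<close> lies in \<open>J\<close>, the ring commutator agrees modulo \<open>J\<^bsup>r+s+1\<^esup>\<close> with \<open>c - 1\<close> for an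
  element \<open>c\<close> of the dimension subgroup of index \<open>r + s\<close>.\<close>

lemma commutator_in_additive_subgroup:
  assumes "g \<in> dim_subgroup r" "h \<in> dim_subgroup s" "additive_subgroup H R" "P (Suc (r + s)) \<subseteq> H"
    "\<And>c. c \<in> dim_subgroup (r + s) \<Longrightarrow> diff_one c \<in> H"
  shows "diff_one g \<otimes> diff_one h \<ominus> diff_one h \<otimes> diff_one g \<in> H"
proof -
  let ?k = "h \<otimes>\<^bsub>G\<^esub> g"
  let ?c = "inv\<^bsub>G\<^esub> ?k \<otimes>\<^bsub>G\<^esub> (g \<otimes>\<^bsub>G\<^esub> h)"
  note c = dim_subgroup_carrier[OF assms(1)] dim_subgroup_carrier[OF assms(2)]
  note d = commutator_in_dim_subgroup[OF assms(1,2)]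
  have k: "?k \<in> carrier G" and cc: "?c \<in> carrier G" using c by auto
  have "diff_one ?k \<in> P (Suc 0)" using diff_one_in_augmentation[OF k] by (simp add: P_1)
  from P_mult[OF this dim_subgroupD[OF d]] have "diff_one ?k \<otimes> diff_one ?c \<in> H"
    using assms(4) by auto
  moreover have "diff_one ?c \<in> H" by (rule assms(5)[OF d])
  ultimately have "diff_one ?c \<oplus> diff_one ?k \<otimes> diff_one ?c \<in> H"
    by (intro additive_subgroup.a_closed[OF assms(3)])
  also have "diff_one ?c \<oplus> diff_one ?k \<otimes> diff_one ?c = u ?k \<otimes> diff_one ?c"
    using k cc by (simp add: u_eq_diff_one l_distr)
  finally show ?thesis by (simp add: diff_one_commutator[OF c])
qed

text \<open>Modulo \<open>J\<^bsup>r+1\<^esup>\<close> the map \<open>h \<mapsto> h - 1\<close> turns products into sums on the \<open>r\<close>th dimension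
  subgroup, because the error term \<open>(h - 1)(k - 1)\<close> lies in \<open>J\<^bsup>2r\<^esup>\<close>.  So the elements \<open>h\<close> that
  satisfy the conclusion form a subgroup \<open>K\<close>.  It contains the next dimension subgroup and the
  elements \<open>x\<^sub>i\<close>, and therefore every coset in the subgroup that they generate in the quotient.\<close>

lemma diff_one_in_span_of_generators:
  assumes r: "r \<ge> 1" and x: "\<And>i. i \<in> I \<Longrightarrow> x i \<in> dim_subgroup r"
    and gen: "generate ((G\<lparr>carrier := dim_subgroup r\<rparr>) Mod dim_subgroup (Suc r))
        ((\<lambda>i. dim_subgroup (Suc r) #>\<^bsub>G\<^esub> x i) ` I)
      = carrier ((G\<lparr>carrier := dim_subgroup r\<rparr>) Mod dim_subgroup (Suc r))"
    and h: "h \<in> dim_subgroup r"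
  shows "diff_one h \<in> add_span ((\<lambda>i. diff_one (x i)) ` I \<union> P (Suc r))"
proof -
  let ?D = "dim_subgroup r" and ?N = "dim_subgroup (Suc r)"
  let ?S = "(\<lambda>i. diff_one (x i)) ` I \<union> P (Suc r)"
  let ?GD = "G\<lparr>carrier := ?D\<rparr>"
  have Sc: "?S \<subseteq> carrier R" using x P_carrier by (auto dest: dim_subgroup_carrier)
  note span = additive_subgroup_add_span[OF Sc]
  define K where "K = {k \<in> ?D. diff_one k \<in> add_span ?S}"
  have prod: "y \<otimes> z \<in> add_span ?S" if "y \<in> P r" "z \<in> P r" for y z
    using P_mult[OF that] P_antimono[of "Suc r" "r + r"] r by (auto intro: add_span_incl)
  have K: "subgroup K G"
  proof (rule G.subgroupI)
    show "K \<subseteq> carrier G" by (auto simp: K_def dest: dim_subgroup_carrier)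
    have "\<one>\<^bsub>G\<^esub> \<in> K"
      using subgroup.one_closed[OF dim_subgroup_is_subgroup] zero_in_add_span
      by (auto simp: K_def diff_one_one)
    thus "K \<noteq> {}" by blast
    fix k assume k: "k \<in> K"
    hence kD: "k \<in> ?D" and kS: "diff_one k \<in> add_span ?S" by (auto simp: K_def)
    note kc = dim_subgroup_carrier[OF kD]
    have kinv: "inv\<^bsub>G\<^esub> k \<in> ?D" by (rule subgroup.m_inv_closed[OF dim_subgroup_is_subgroup kD])
    have "diff_one k \<oplus> diff_one (inv\<^bsub>G\<^esub> k) \<otimes> diff_one k \<in> add_span ?S"
      using kS prod[OF dim_subgroupD[OF kinv] dim_subgroupD[OF kD]]
      by (rule additive_subgroup.a_closed[OF span])
    also have "diff_one k \<oplus> diff_one (inv\<^bsub>G\<^esub> k) \<otimes> diff_one k = u (inv\<^bsub>G\<^esub> k) \<otimes> diff_one k"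
      using kc by (simp add: u_eq_diff_one l_distr)
    finally show "inv\<^bsub>G\<^esub> k \<in> K"
      using kinv additive_subgroup.a_inv_closed[OF span]
      by (simp add: K_def diff_one_inv[OF kc])
    fix l assume l: "l \<in> K"
    hence lD: "l \<in> ?D" and lS: "diff_one l \<in> add_span ?S" by (auto simp: K_def)
    show "k \<otimes>\<^bsub>G\<^esub> l \<in> K"
      using subgroup.m_closed[OF dim_subgroup_is_subgroup kD lD]
        prod[OF dim_subgroupD[OF kD] dim_subgroupD[OF lD]] kS lS
      by (auto simp: K_def diff_one_mult[OF kc dim_subgroup_carrier[OF lD]]
          intro!: additive_subgroup.a_closed[OF span])
  qed
  have NK: "?N \<subseteq> K"
    using dim_subgroup_Suc_subset[of r] by (auto simp: K_def dest: dim_subgroupD intro: add_span_incl)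
  have xK: "x i \<in> K" if "i \<in> I" for i
    using x[OF that] that by (auto simp: K_def intro: add_span_incl)
  have normal: "?N \<lhd> ?GD"
    by (rule G.normal_restrict_supergroup[OF dim_subgroup_is_subgroup dim_subgroup_normal
          dim_subgroup_Suc_subset])
  interpret N: normal ?N ?GD by (rule normal)
  have cosetK: "?N #>\<^bsub>G\<^esub> k \<subseteq> K" if "k \<in> K" for k
    using NK that subgroup.m_closed[OF K] by (auto simp: r_coset_def)
  have "C \<subseteq> K" if "C \<in> generate (?GD Mod ?N) ((\<lambda>i. ?N #>\<^bsub>G\<^esub> x i) ` I)" for C
    using that
  proof induction
    case one
    thus ?case using NK by simp
  next
    case (incl C)
    thus ?case using cosetK xK by blast
  next
    case (inv C)
    then obtain i where i: "i \<in> I" "C = ?N #>\<^bsub>G\<^esub> x i" by blast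
    hence Cmem: "C \<in> carrier (?GD Mod ?N)" using x by (auto simp: carrier_FactGroup)
    have CK: "C \<subseteq> K" using i cosetK xK by blast
    have "inv\<^bsub>?GD\<^esub> c \<in> K" if "c \<in> C" for c
    proof -
      have "c \<in> K" "c \<in> ?D" using CK that by (auto simp: K_def)
      thus ?thesis using subgroup.m_inv_closed[OF K]
          G.m_inv_consistent[OF dim_subgroup_is_subgroup[of r]] by simp
    qed
    thus ?case by (auto simp: N.inv_FactGroup[OF Cmem] SET_INV_def)
  next
    case (eng C E)
    thus ?case using subgroup.m_closed[OF K] by (force simp: set_mult_def)
  qed
  moreover have "?N #>\<^bsub>G\<^esub> h \<in> carrier (?GD Mod ?N)" using h by (auto simp: carrier_FactGroup)
  ultimately have "?N #>\<^bsub>G\<^esub> h \<subseteq> K" using gen by blast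
  moreover have "h \<in> ?N #>\<^bsub>G\<^esub> h"
    using subgroup.one_closed[OF dim_subgroup_is_subgroup] dim_subgroup_carrier[OF h]
    by (force simp: r_coset_def)
  ultimately show ?thesis by (auto simp: K_def)
qed

text \<open>Otherwise the coset of \<open>x\<^sub>i\<close> is the identity of the quotient, and dropping it from the family
  leaves a generating family.\<close>

lemma minimal_generator_not_in_next:
  assumes min: "minimal_generating_family ((G\<lparr>carrier := dim_subgroup r\<rparr>) Mod dim_subgroup (Suc r))
      (\<lambda>i. dim_subgroup (Suc r) #>\<^bsub>G\<^esub> x i) I" and i: "i \<in> I"
  shows "x i \<notin> dim_subgroup (Suc r)"
proof
  let ?N = "dim_subgroup (Suc r)"
  let ?Q = "(G\<lparr>carrier := dim_subgroup r\<rparr>) Mod ?N" and ?y = "\<lambda>i. ?N #>\<^bsub>G\<^esub> x i"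
  assume "x i \<in> ?N"
  hence yi: "?y i = \<one>\<^bsub>?Q\<^esub>"
    using G.coset_join2[OF dim_subgroup_carrier dim_subgroup_is_subgroup] by simp
  have normal: "?N \<lhd> G\<lparr>carrier := dim_subgroup r\<rparr>"
    by (rule G.normal_restrict_supergroup[OF dim_subgroup_is_subgroup dim_subgroup_normal
          dim_subgroup_Suc_subset])
  interpret Q: group ?Q by (rule normal.factorgroup_is_group[OF normal])
  have "?y ` I \<subseteq> carrier ?Q" using min by (simp add: minimal_generating_family_def)
  hence sub: "subgroup (generate ?Q (?y ` (I - {i}))) ?Q"
    by (intro Q.generate_is_subgroup) blast
  have "?y ` I \<subseteq> generate ?Q (?y ` (I - {i}))"
  proof (rule image_subsetI)
    fix j assume "j \<in> I"
    thus "?y j \<in> generate ?Q (?y ` (I - {i}))"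
      using generate.one[of ?Q] generate.incl[of "?y j" "?y ` (I - {i})" ?Q] yi by (cases "j = i") auto
  qed
  hence "generate ?Q (?y ` I) \<subseteq> generate ?Q (?y ` (I - {i}))"
    by (rule Q.generate_subgroup_incl[OF _ sub])
  moreover have "generate ?Q (?y ` (I - {i})) \<subseteq> carrier ?Q" using subgroup.subset[OF sub] .
  ultimately have "generate ?Q (?y ` (I - {i})) = carrier ?Q"
    using min unfolding minimal_generating_family_def by blast
  moreover have "I - {i} \<subset> I" using i by blast
  ultimately show False using min unfolding minimal_generating_family_def by blast
qed

end

section \<open>Jennings generators\<close>

text \<open>The number \<open>m r\<close> is the size of the block of generators of dimension \<open>r\<close>; the list of the
  generators is the concatenation of these blocks.\<close>

locale jennings_family = p_group_algebra R G p n u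
  for R :: "('a, 'b) ring_scheme" (structure) and G :: "('g, 'c) monoid_scheme"
    and p n :: nat and u :: "'g \<Rightarrow> 'a" +
  fixes g :: "nat \<Rightarrow> 'g" and m :: "nat \<Rightarrow> nat" and a :: "nat \<Rightarrow> 'a"
  assumes blocks: "{1..n} = (\<Union>r\<in>{1..}. block m r)"
    and block_subset: "r \<ge> 1 \<Longrightarrow> g ` block m r \<subseteq> dim_subgroup r"
    and block_generates: "r \<ge> 1 \<Longrightarrow>
      minimal_generating_family ((G\<lparr>carrier := dim_subgroup r\<rparr>) Mod dim_subgroup (Suc r))
        (\<lambda>i. dim_subgroup (Suc r) #>\<^bsub>G\<^esub> g i) (block m r)"
    and a_eq: "i \<in> {1..n} \<Longrightarrow> a i = diff_one (g i)"
begin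

abbreviation "d i \<equiv> rad_dim R (a i)"
abbreviation "img \<equiv> word_image R a"
abbreviation "wdim \<equiv> word_dim R a"
abbreviation "smaller \<equiv> jennings_less R a"

lemma block_letter:
  assumes "r \<ge> 1" "i \<in> block m r"
  shows "i \<in> {1..n}" "g i \<in> dim_subgroup r" "d i = r"
proof -
  show i: "i \<in> {1..n}" using assms blocks by auto
  show gi: "g i \<in> dim_subgroup r" using assms block_subset by blast
  have "g i \<notin> dim_subgroup (Suc r)"
    by (rule minimal_generator_not_in_next[OF block_generates[OF assms(1)] assms(2)])
  thus "d i = r"
    using gi a_eq[OF i] dim_subgroup_carrier[OF gi] by (intro P_rad_dim) (auto simp: dim_subgroup_def)
qed

lemma letter_block:
  assumes "i \<in> {1..n}"
  shows "d i \<ge> 1" "i \<in> block m (d i)" "g i \<in> dim_subgroup (d i)"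
proof -
  have "i \<in> (\<Union>r\<in>{1..}. block m r)" using assms blocks by blast
  then obtain r where "r \<ge> 1" "i \<in> block m r" by auto
  thus "d i \<ge> 1" "i \<in> block m (d i)" "g i \<in> dim_subgroup (d i)" using block_letter[of r i] by auto
qed

lemma a_in_P: "i \<in> {1..n} \<Longrightarrow> a i \<in> P (d i)"
  using a_eq letter_block(3) by (simp add: dim_subgroup_def)

lemma a_closed [simp, intro]: "i \<in> {1..n} \<Longrightarrow> a i \<in> carrier R"
  using a_in_P P_carrier by blast

lemma wdim_Nil [simp]: "wdim [] = 0"
  by (simp add: word_dim_def)

lemma wdim_Cons [simp]: "wdim (i # w) = d i + wdim w"
  by (simp add: word_dim_def)

lemma img_closed [simp, intro]: "w \<in> words n \<Longrightarrow> img w \<in> carrier R"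
  by (induction w) auto

lemma img_append: "v \<in> words n \<Longrightarrow> w \<in> words n \<Longrightarrow> img (v @ w) = img v \<otimes> img w"
  by (induction v) (auto simp: m_assoc)

lemma img_in_P: "w \<in> words n \<Longrightarrow> img w \<in> P (wdim w)"
  by (induction w) (auto intro!: P_mult[OF a_in_P])

lemma length_le_wdim: "w \<in> words n \<Longrightarrow> length w \<le> wdim w"
  using letter_block(1) by (induction w) force+

text \<open>The leading term of \<open>h - 1\<close> is a linear combination of single letters of dimension \<open>r\<close>.  Single
  letters are the shortest nonempty words, which is why such a combination lies below every
  word of dimension \<open>r\<close> and length at least two.\<close>

lemma diff_one_leading_part:
  assumes "r \<ge> 1" "h \<in> dim_subgroup r"
  shows "diff_one h \<in> add_span (a ` block m r \<union> P (Suc r))"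
proof -
  have "(\<lambda>i. diff_one (g i)) ` block m r = a ` block m r"
    using a_eq block_letter(1)[OF assms(1)] by (intro image_cong) auto
  thus ?thesis
    using diff_one_in_span_of_generators[OF assms(1) _ _ assms(2), of "block m r" g]
      block_letter(2)[OF assms(1)] block_generates[OF assms(1)]
    by (simp add: minimal_generating_family_def)
qed

definition words_from_dim :: "nat \<Rightarrow> 'a set" where
  "words_from_dim r = img ` {w \<in> words n. wdim w \<ge> r}"

lemma words_from_dim_in_P: "words_from_dim r \<subseteq> P r"
  using img_in_P P_antimono by (fastforce simp: words_from_dim_def)

lemma words_from_dim_carrier: "words_from_dim r \<subseteq> carrier R"
  by (auto simp: words_from_dim_def)

lemma words_from_dim_P_carrier: "words_from_dim r \<union> P s \<subseteq> carrier R"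
  using words_from_dim_carrier P_carrier by blast

lemma img_in_words_from_dim: "w \<in> words n \<Longrightarrow> wdim w \<ge> r \<Longrightarrow> img w \<in> words_from_dim r"
  by (auto simp: words_from_dim_def)

lemma augmentation_subset_span: "augmentation_ideal \<subseteq> add_span (a ` block m 1 \<union> P 2)"
  unfolding augmentation_ideal_def
proof (rule add_span_trans)
  show "a ` block m 1 \<union> P 2 \<subseteq> carrier R" using block_letter(1)[of 1] P_carrier by auto
  show "diff_one ` carrier G \<subseteq> add_span (a ` block m 1 \<union> P 2)"
  proof (rule image_subsetI)
    fix h assume h: "h \<in> carrier G"
    hence "h \<in> dim_subgroup 1" using diff_one_in_augmentation by (auto simp: dim_subgroup_def P_1)
    thus "diff_one h \<in> add_span (a ` block m 1 \<union> P 2)"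
      using diff_one_leading_part[of 1 h] by (simp add: numeral_2_eq_2)
  qed
qed

text \<open>Modulo \<open>J\<^sup>2\<close> every element of the radical is a combination of letters of dimension one, so the
  step from \<open>r\<close> to \<open>r + 1\<close> appends such a letter to the words.\<close>

lemma P_subset_span_step: "P r \<subseteq> add_span (words_from_dim r \<union> P (Suc r))"
proof (induction r)
  case 0
  let ?S = "words_from_dim 0 \<union> P (Suc 0)"
  note sub = additive_subgroup_add_span[OF words_from_dim_P_carrier]
  show ?case
  proof
    fix x assume "x \<in> P 0"
    hence x: "x \<in> carrier R" by simp
    obtain k :: int where k: "x \<ominus> [k] \<cdot> \<one> \<in> augmentation_ideal"
      using integer_mod_augmentation[OF x] by blast
    have "\<one> \<in> words_from_dim 0" using img_in_words_from_dim[of "[]" 0] by simp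
    hence "[k] \<cdot> \<one> \<in> add_span ?S"
      by (intro additive_subgroup_add_pow[OF sub] add_span_incl) blast
    moreover have "x \<ominus> [k] \<cdot> \<one> \<in> add_span ?S" using k by (intro add_span_incl) (simp add: P_1)
    ultimately have "x \<ominus> [k] \<cdot> \<one> \<oplus> [k] \<cdot> \<one> \<in> add_span ?S"
      by (intro additive_subgroup.a_closed[OF sub])
    thus "x \<in> add_span ?S" using x by (simp add: a_minus_def a_assoc l_neg)
  qed
next
  case (Suc r)
  let ?T = "a ` block m 1 \<union> P 2" and ?H = "add_span (words_from_dim (Suc r) \<union> P (Suc (Suc r)))"
  note sub = additive_subgroup_add_span[OF words_from_dim_P_carrier]
  have T: "?T \<subseteq> carrier R" using block_letter(1)[of 1] P_carrier by auto
  have TP: "t \<in> P (Suc 0)" if "t \<in> ?T" for t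
    using that
  proof
    assume "t \<in> a ` block m 1"
    then obtain i where i: "i \<in> block m 1" "t = a i" by blast
    thus ?thesis using a_in_P[of i] block_letter[OF order.refl i(1)] by simp
  next
    assume "t \<in> P 2"
    thus ?thesis using P_antimono[of "Suc 0" 2] by auto
  qed
  show ?case
    unfolding rad_power.simps(2)[of R r]
  proof (rule ideal_prod_least[OF sub])
    fix x y assume x: "x \<in> P r" and y: "y \<in> jacobson_radical R"
    have yT: "y \<in> add_span ?T" using y augmentation_subset_span jacobson_eq_augmentation by auto
    show "x \<otimes> y \<in> ?H"
    proof (rule add_span_mult[OF subsetD[OF Suc x] yT words_from_dim_P_carrier T sub])
      fix s t assume s: "s \<in> words_from_dim r \<union> P (Suc r)" and t: "t \<in> ?T"
      have "s \<otimes> t \<in> words_from_dim (Suc r) \<union> P (Suc (Suc r))"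
      proof (cases "s \<in> words_from_dim r \<and> t \<in> a ` block m 1")
        case True
        then obtain w i where w: "w \<in> words n" "wdim w \<ge> r" "s = img w"
          and i: "i \<in> block m 1" "t = a i"
          by (auto simp: words_from_dim_def)
        have "s \<otimes> t = img (w @ [i])" using w i block_letter(1)[of 1 i] by (simp add: img_append)
        moreover have "img (w @ [i]) \<in> words_from_dim (Suc r)"
          using w i block_letter[of 1 i] by (intro img_in_words_from_dim) auto
        ultimately show ?thesis by simp
      next
        case False
        hence "s \<in> P r \<and> t \<in> P 2 \<or> s \<in> P (Suc r) \<and> t \<in> P (Suc 0)"
          using s t TP words_from_dim_in_P by blast
        thus ?thesis using P_mult[of s r t 2] P_mult[of s "Suc r" t "Suc 0"] by auto
      qed
      thus "s \<otimes> t \<in> ?H" by (rule add_span_incl)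
    qed
  qed
qed

text \<open>Iterating the previous lemma pushes the error term into arbitrarily high powers of the radical,
  and these vanish.\<close>

theorem P_eq_span_words: "P r = add_span (words_from_dim r)"
proof
  show "add_span (words_from_dim r) \<subseteq> P r"
    by (rule add_span_least[OF P_subgroup words_from_dim_in_P])
  have step: "P r \<subseteq> add_span (words_from_dim r \<union> P (r + k))" for k
  proof (induction k)
    case 0
    show ?case by (auto intro: add_span_incl)
  next
    case (Suc k)
    have "words_from_dim r \<union> P (r + k) \<subseteq> add_span (words_from_dim r \<union> P (r + Suc k))"
    proof -
      have "words_from_dim (r + k) \<subseteq> words_from_dim r" by (auto simp: words_from_dim_def)
      hence "add_span (words_from_dim (r + k) \<union> P (Suc (r + k)))
          \<subseteq> add_span (words_from_dim r \<union> P (r + Suc k))"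
        by (intro add_span_mono) auto
      thus ?thesis using P_subset_span_step[of "r + k"] by (auto intro: add_span_incl)
    qed
    thus ?case using Suc add_span_trans[OF words_from_dim_P_carrier] by blast
  qed
  obtain N where N: "P N = {\<zero>}" using radical_nilpotent by blast
  have "P (r + N) \<subseteq> {\<zero>}" using P_antimono[of N "r + N"] N by simp
  hence "words_from_dim r \<union> P (r + N) \<subseteq> add_span (words_from_dim r)"
    using zero_in_add_span by (auto intro: add_span_incl)
  thus "P r \<subseteq> add_span (words_from_dim r)"
    using step[of N] add_span_trans[OF words_from_dim_carrier] by blast
qed

definition span_below :: "nat list \<Rightarrow> 'a set" where
  "span_below w = add_span (img ` {v \<in> words n. smaller v w})"

text \<open>The image of \<open>w\<close> is a linear combination of images of smaller words.  This is the property of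
  being a tip, read off in the group algebra instead of the free algebra.\<close>

definition reducible :: "nat list \<Rightarrow> bool" where
  "reducible w \<longleftrightarrow> w \<in> words n \<and> img w \<in> span_below w"

lemma smaller_subset: "img ` {v \<in> words n. smaller v w} \<subseteq> carrier R"
  by auto

lemma span_below_subgroup: "additive_subgroup (span_below w) R"
  unfolding span_below_def by (rule additive_subgroup_add_span[OF smaller_subset])

lemma img_in_span_below: "v \<in> words n \<Longrightarrow> smaller v w \<Longrightarrow> img v \<in> span_below w"
  unfolding span_below_def by (auto intro: add_span_incl)

lemma P_subset_span_below: "P (Suc (wdim w)) \<subseteq> span_below w"
  unfolding P_eq_span_words
  by (rule add_span_least[OF span_below_subgroup])
    (auto simp: words_from_dim_def jennings_less_def intro!: img_in_span_below)

text \<open>An element of the dimension subgroup with the dimension of \<open>w\<close> contributes only letters of that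
  dimension, which are shorter than \<open>w\<close>, and words of larger dimension; both are smaller
  than \<open>w\<close>.\<close>

lemma diff_one_in_span_below:
  assumes "h \<in> dim_subgroup (wdim w)" "w \<in> words n" "length w \<ge> 2"
  shows "diff_one h \<in> span_below w"
proof -
  have r: "wdim w \<ge> 1" using length_le_wdim[OF assms(2)] assms(3) by simp
  show ?thesis
  proof (rule add_span_leastD[OF diff_one_leading_part[OF r assms(1)] span_below_subgroup])
    fix s assume "s \<in> a ` block m (wdim w) \<union> P (Suc (wdim w))"
    thus "s \<in> span_below w"
    proof
      assume "s \<in> a ` block m (wdim w)"
      then obtain i where i: "i \<in> block m (wdim w)" "s = a i" by blast
      note b = block_letter[OF r i(1)]
      have "img [i] \<in> span_below w"
        using b assms(3) by (intro img_in_span_below) (auto simp: jennings_less_def)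
      thus ?thesis using b(1) i(2) by simp
    qed (use P_subset_span_below in blast)
  qed
qed

text \<open>The image of \<open>a\<^sub>j a\<^sub>k\<close> is that of \<open>a\<^sub>k a\<^sub>j\<close> plus a ring commutator.  The word \<open>a\<^sub>k a\<^sub>j\<close> has the same dimension and
  length and is lexicographically larger, hence smaller in the Jennings order; the commutator is
  handled by dimension and length.\<close>

lemma reducible_ascending_pair:
  assumes "1 \<le> j" "j < k" "k \<le> n"
  shows "reducible [j, k]"
proof -
  have j: "j \<in> {1..n}" and k: "k \<in> {1..n}" using assms by auto
  have w: "[j, k] \<in> words n" "[k, j] \<in> words n" using j k by auto
  have dim: "wdim [j, k] = d j + d k" by simp
  have "a j \<otimes> a k \<ominus> a k \<otimes> a j \<in> span_below [j, k]"
    unfolding a_eq[OF j] a_eq[OF k]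
  proof (rule commutator_in_additive_subgroup[OF letter_block(3)[OF j] letter_block(3)[OF k]
        span_below_subgroup])
    show "P (Suc (d j + d k)) \<subseteq> span_below [j, k]" using P_subset_span_below[of "[j, k]"] by simp
    show "diff_one c \<in> span_below [j, k]" if "c \<in> dim_subgroup (d j + d k)" for c
      using that w(1) by (intro diff_one_in_span_below) auto
  qed
  moreover have "img [k, j] \<in> span_below [j, k]"
    using w(2) assms by (intro img_in_span_below) (auto simp: jennings_less_def)
  ultimately have "(a j \<otimes> a k \<ominus> a k \<otimes> a j) \<oplus> a k \<otimes> a j \<in> span_below [j, k]"
    using j k by (intro additive_subgroup.a_closed[OF span_below_subgroup]) auto
  hence "img [j, k] \<in> span_below [j, k]"
    using j k by (simp add: a_minus_def a_assoc l_neg)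
  thus ?thesis using w by (simp add: reducible_def)
qed

lemma wdim_replicate: "wdim (replicate k i) = k * d i"
  by (induction k) auto

lemma img_replicate: "i \<in> {1..n} \<Longrightarrow> img (replicate k i) = a i [^] k"
proof (induction k)
  case (Suc k)
  thus ?case using nat_pow_comm[OF a_closed[OF Suc.prems], of k 1] by simp
qed simp

text \<open>Here \<open>a\<^sub>i\<^sup>p = g\<^sub>i\<^sup>p - 1\<close>, and the \<open>p\<close>th power of \<open>g\<^sub>i\<close> lies in the dimension subgroup whose index
  is the dimension of the word \<open>a\<^sub>i\<^sup>p\<close>.\<close>

lemma reducible_power:
  assumes i: "i \<in> {1..n}"
  shows "reducible (replicate p i)"
proof -
  note gi = letter_block(3)[OF i]
  have "diff_one (g i [^]\<^bsub>G\<^esub> p) \<in> span_below (replicate p i)"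
    using pow_p_in_dim_subgroup[OF gi] i prime_ge_2_nat[OF prime_p]
    by (intro diff_one_in_span_below) (auto simp: wdim_replicate words_replicate mult.commute)
  thus ?thesis
    using i dim_subgroup_carrier[OF gi]
    by (simp add: reducible_def words_replicate img_replicate diff_one_pow_p a_eq)
qed

text \<open>The Jennings order is compatible with multiplication on both sides.\<close>

lemma reducible_context:
  assumes v: "reducible v" and x: "x \<in> words n" and y: "y \<in> words n"
  shows "reducible (x @ v @ y)"
proof -
  have vw: "v \<in> words n" using v by (simp add: reducible_def)
  have "img x \<otimes> img v \<otimes> img y \<in> span_below (x @ v @ y)"
  proof -
    have "img v \<in> {z \<in> carrier R. img x \<otimes> z \<in>
        {z \<in> carrier R. z \<otimes> img y \<in> span_below (x @ v @ y)}}"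
    proof (rule add_span_leastD)
      show "img v \<in> add_span (img ` {z \<in> words n. smaller z v})"
        using v by (simp add: reducible_def span_below_def)
      show "additive_subgroup {z \<in> carrier R. img x \<otimes> z \<in>
          {z \<in> carrier R. z \<otimes> img y \<in> span_below (x @ v @ y)}} R"
        using x y by (intro additive_subgroup_left_preimage additive_subgroup_right_preimage
            span_below_subgroup) auto
      fix s assume "s \<in> img ` {z \<in> words n. smaller z v}"
      then obtain z where z: "z \<in> words n" "smaller z v" "s = img z" by blast
      have "img (x @ z @ y) \<in> span_below (x @ v @ y)"
        using z x y by (intro img_in_span_below jennings_less_context) auto
      thus "s \<in> {z \<in> carrier R. img x \<otimes> z \<in>
          {z \<in> carrier R. z \<otimes> img y \<in> span_below (x @ v @ y)}}"
        using z x y by (simp add: img_append m_assoc)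
    qed
    thus ?thesis by simp
  qed
  thus ?thesis using x y vw by (simp add: reducible_def img_append m_assoc)
qed

lemma reducible_if_factor:
  assumes "reducible v" "sublist v w" "w \<in> words n"
  shows "reducible w"
proof -
  obtain x y where "w = x @ v @ y" using assms(2) by (auto simp: sublist_def)
  thus ?thesis using reducible_context[OF assms(1), of x y] assms(3) by auto
qed

abbreviation "nwords \<equiv> normal_words p n"

lemma reducible_if_not_normal: "w \<in> words n \<Longrightarrow> w \<notin> nwords \<Longrightarrow> reducible w"
  using normal_word_if_no_bad_factor[of w n p] prime_gt_0_nat[OF prime_p]
    reducible_if_factor reducible_power reducible_ascending_pair by blast

lemma normal_img_subset: "img ` {v \<in> nwords. Q v} \<subseteq> carrier R"
  using normal_words_subset by blast

text \<open>Replace a word that is not normal by smaller words, again and again.  The order can have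
  infinite descending chains, because the dimension is unbounded; but words of dimension at least \<open>N\<close>,
  where \<open>J\<^sup>N = 0\<close>, have image zero, and only finitely many words remain.\<close>

lemma img_in_span_normal:
  assumes "w \<in> words n"
  shows "img w \<in> add_span (img ` {v \<in> nwords. v = w \<or> smaller v w})"
proof -
  obtain N where N: "P N = {\<zero>}" using radical_nilpotent by blast
  \<comment> \<open>The finite set whose size decreases along a reduction.\<close>
  define below where "below = (\<lambda>w. {v \<in> words n. wdim v < N \<and> smaller v w})"
  have fin: "finite (below w)" for w
  proof (rule finite_subset)
    show "below w \<subseteq> {v. set v \<subseteq> {1..n} \<and> length v \<le> N}"
      using length_le_wdim by (fastforce simp: below_def words_def)
    show "finite {v. set v \<subseteq> {1..n} \<and> length v \<le> N}" by (rule finite_lists_length_le) simp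
  qed
  show ?thesis using assms
  proof (induction "card (below w)" arbitrary: w rule: less_induct)
    case less
    let ?T = "img ` {v \<in> nwords. v = w \<or> smaller v w}"
    show ?case
    proof (cases "w \<in> nwords")
      case True
      thus ?thesis by (intro add_span_incl) blast
    next
      case False
      hence "img w \<in> span_below w" using reducible_if_not_normal less.prems by (simp add: reducible_def)
      hence w: "img w \<in> add_span (img ` {v \<in> words n. smaller v w})" by (simp add: span_below_def)
      show ?thesis
      proof (rule add_span_leastD[OF w])
        show "additive_subgroup (add_span ?T) R"
          by (rule additive_subgroup_add_span[OF normal_img_subset])
        fix s assume "s \<in> img ` {v \<in> words n. smaller v w}"
        then obtain v where v: "v \<in> words n" "smaller v w" "s = img v" by blast
        show "s \<in> add_span ?T"
        proof (cases "wdim v < N")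
          case False
          hence "img v \<in> P N" using img_in_P[OF v(1)] P_antimono[of N "wdim v"] by auto
          thus ?thesis using N v(3) zero_in_add_span by simp
        next
          case True
          have "below v \<subset> below w"
          proof
            show "below v \<subseteq> below w" using v jennings_less_trans by (fastforce simp: below_def)
            show "below v \<noteq> below w" using v True jennings_less_irrefl by (force simp: below_def)
          qed
          hence "card (below v) < card (below w)" by (rule psubset_card_mono[OF fin])
          hence "img v \<in> add_span (img ` {x \<in> nwords. x = v \<or> smaller x v})"
            using less.hyps v(1) by blast
          moreover have "img ` {x \<in> nwords. x = v \<or> smaller x v} \<subseteq> ?T"
            using v(2) jennings_less_trans by blast
          ultimately show ?thesis using v(3) add_span_mono by blast
        qed
      qed
    qed
  qed
qed

lemma carrier_eq_span_normal: "carrier R = add_span (img ` nwords)"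
proof
  have c: "img ` nwords \<subseteq> carrier R" using normal_img_subset[of "\<lambda>_. True"] by simp
  show "add_span (img ` nwords) \<subseteq> carrier R" by (rule add_span_in_carrier[OF c])
  have "words_from_dim 0 \<subseteq> add_span (img ` nwords)"
  proof
    fix x assume "x \<in> words_from_dim 0"
    then obtain w where w: "w \<in> words n" "x = img w" by (auto simp: words_from_dim_def)
    have "add_span (img ` {v \<in> nwords. v = w \<or> smaller v w}) \<subseteq> add_span (img ` nwords)"
      by (intro add_span_mono) blast
    thus "x \<in> add_span (img ` nwords)" using img_in_span_normal[OF w(1)] w(2) by blast
  qed
  thus "carrier R \<subseteq> add_span (img ` nwords)"
    using add_span_trans[OF c] P_eq_span_words[of 0] by simp
qed

text \<open>There are at most \<open>p\<^sup>n = |G|\<close> normal words and they span a space with \<open>p\<^bsup>|G|\<^esup>\<close> elements, so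
  none of them can be omitted.\<close>

lemma normal_independent:
  assumes v: "v \<in> nwords"
  shows "img v \<notin> add_span (img ` (nwords - {v}))"
proof
  let ?S = "img ` (nwords - {v})"
  assume mem: "img v \<in> add_span ?S"
  have S: "?S \<subseteq> carrier R" using normal_words_subset by blast
  have fin: "finite nwords" and card: "card nwords \<le> p ^ n"
    using normal_words_finite_card prime_gt_0_nat[OF prime_p] by blast+
  have "img ` nwords \<subseteq> add_span ?S" using mem by (auto intro: add_span_incl)
  hence "carrier R \<subseteq> add_span ?S" unfolding carrier_eq_span_normal by (rule add_span_trans[OF S])
  moreover have "finite (add_span ?S) \<and> card (add_span ?S) \<le> p ^ card ?S"
    using fin S by (intro card_add_span_le) (auto simp: char_p prime_gt_0_nat[OF prime_p])
  ultimately have "p ^ p ^ n \<le> p ^ card ?S" using card_R card_mono[of "add_span ?S" "carrier R"] by auto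
  also have "\<dots> \<le> p ^ (p ^ n - 1)"
  proof (rule power_increasing)
    have "card ?S \<le> card (nwords - {v})" using fin by (intro card_image_le) simp
    thus "card ?S \<le> p ^ n - 1" using card v fin by simp
  qed (use prime_gt_0_nat[OF prime_p] in simp)
  also have "\<dots> < p ^ p ^ n"
    using prime_gt_1_nat[OF prime_p] by (intro power_strict_increasing) simp_all
  finally show False by simp
qed

lemma not_reducible_normal:
  assumes w: "w \<in> nwords"
  shows "\<not> reducible w"
proof
  assume "reducible w"
  hence "img w \<in> add_span (img ` {v \<in> words n. smaller v w})" by (simp add: reducible_def span_below_def)
  moreover have "add_span (img ` {v \<in> words n. smaller v w}) \<subseteq> add_span (img ` (nwords - {w}))"
  proof (rule add_span_trans)
    show "img ` (nwords - {w}) \<subseteq> carrier R" using normal_words_subset by blast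
    show "img ` {v \<in> words n. smaller v w} \<subseteq> add_span (img ` (nwords - {w}))"
    proof (rule image_subsetI)
      fix v assume "v \<in> {v \<in> words n. smaller v w}"
      hence v: "v \<in> words n" "smaller v w" by auto
      have "{x \<in> nwords. x = v \<or> smaller x v} \<subseteq> nwords - {w}"
        using v(2) jennings_less_irrefl jennings_less_trans by blast
      hence "add_span (img ` {x \<in> nwords. x = v \<or> smaller x v}) \<subseteq> add_span (img ` (nwords - {w}))"
        by (intro add_span_mono image_mono)
      thus "img v \<in> add_span (img ` (nwords - {w}))" using img_in_span_normal[OF v(1)] by blast
    qed
  qed
  ultimately show False using normal_independent[OF w] by blast
qed

theorem reducible_iff: "w \<in> words n \<Longrightarrow> reducible w \<longleftrightarrow> w \<notin> nwords"
  using not_reducible_normal reducible_if_not_normal by blast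

text \<open>The power \<open>J\<^bsup>dim w + 1\<^esup>\<close> is spanned by words of larger dimension, all of them smaller than
  \<open>w\<close>, so membership of the image would make \<open>w\<close> reducible.\<close>

theorem normal_word_exact_power:
  assumes w: "w \<in> nwords"
  shows "img w \<in> P r - P (Suc r) \<longleftrightarrow> wdim w = r"
proof -
  have ww: "w \<in> words n" using w normal_words_subset by blast
  have in_P: "img w \<in> P (wdim w)" by (rule img_in_P[OF ww])
  have not_in: "img w \<notin> P (Suc (wdim w))"
    using not_reducible_normal[OF w] ww subsetD[OF P_subset_span_below[of w], of "img w"]
    unfolding reducible_def by blast
  have "rad_dim R (img w) = wdim w" by (rule P_rad_dim[OF in_P not_in])
  moreover have "rad_dim R (img w) = r" if "img w \<in> P r - P (Suc r)"
    using that by (intro P_rad_dim) auto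
  ultimately show ?thesis using in_P not_in by auto
qed

text \<open>A reducible word is not normal and so contains one of the two kinds of bad factor, which is
  reducible itself.  Conversely a proper factor of a bad factor is too short to contain a bad
  factor.\<close>

lemma minimal_reducible_iff:
  "reducible w \<and> (\<forall>v. strict_sublist v w \<longrightarrow> v \<in> nwords) \<longleftrightarrow>
    (\<exists>i\<in>{1..n}. w = replicate p i) \<or> (\<exists>j k. 1 \<le> j \<and> j < k \<and> k \<le> n \<and> w = [j, k])"
  (is "?L \<longleftrightarrow> ?R")
proof
  assume L: ?L
  hence w: "w \<in> words n" "w \<notin> nwords" using reducible_iff by (auto simp: reducible_def)
  have minimal: "v = w" if "reducible v" "sublist v w" for v
    using that L not_reducible_normal[of v] by (auto simp: strict_sublist_def)
  from w normal_word_if_no_bad_factor[OF w(1) prime_gt_0_nat[OF prime_p]]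
  consider i where "i \<in> {1..n}" "sublist (replicate p i) w"
    | j k where "1 \<le> j" "j < k" "k \<le> n" "sublist [j, k] w" by blast
  thus ?R
  proof cases
    case 1
    thus ?thesis using minimal[OF reducible_power] by blast
  next
    case 2
    thus ?thesis using minimal[OF reducible_ascending_pair] by blast
  qed
next
  assume R: ?R
  have red: "reducible w" using R reducible_power reducible_ascending_pair by blast
  have ww: "w \<in> words n" using red by (simp add: reducible_def)
  have "v \<in> nwords" if v: "strict_sublist v w" for v
  proof (rule normal_word_if_no_bad_factor)
    have sub: "sublist v w" "v \<noteq> w" using v by (auto simp: strict_sublist_def)
    then obtain x y where xy: "w = x @ v @ y" by (auto simp: sublist_def)
    hence len: "length v < length w" using sub(2) by (cases x; cases y) auto
    show "v \<in> words n" using ww xy by simp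
    show "p > 0" by (rule prime_gt_0_nat[OF prime_p])
    have set: "set v \<subseteq> set w" by (rule set_mono_sublist[OF sub(1)])
    show "\<not> sublist (replicate p i) v" for i
      using sublist_length_le[of "replicate p i" v] len R prime_ge_2_nat[OF prime_p] by auto
    show "\<not> sublist [j, k] v" if "j < k" for j k
    proof
      assume jk: "sublist [j, k] v"
      have "{j, k} \<subseteq> set w" using set_mono_sublist[OF jk] set by auto
      thus False using sublist_length_le[OF jk] len R that by (auto split: if_splits)
    qed
  qed
  thus ?L using red by blast
qed

section \<open>Relations between words\<close>

text \<open>The image in the ring of the element of the free algebra with the integer representatives \<open>f\<close>
  as coefficients.\<close>

definition word_combination :: "(nat list \<Rightarrow> int) \<Rightarrow> 'a" where
  "word_combination f = (\<Oplus>w\<in>{w \<in> words n. f w \<noteq> 0}. [f w] \<cdot> img w)"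

lemma word_combination_superset:
  assumes "finite F" "F \<subseteq> words n" "{w \<in> words n. f w \<noteq> 0} \<subseteq> F"
  shows "word_combination f = (\<Oplus>w\<in>F. [f w] \<cdot> img w)"
  unfolding word_combination_def
proof (rule add.finprod_mono_neutral_cong_left[OF assms(1,3)])
  show "[f w] \<cdot> img w = \<zero>" if "w \<in> F - {w \<in> words n. f w \<noteq> 0}" for w
    using that assms(2) by (auto simp: add_pow_int_ge)
  show "(\<lambda>w. [f w] \<cdot> img w) \<in> F \<rightarrow> carrier R" using assms(2) by auto
qed simp

lemma word_combination_cong:
  assumes "\<And>w. w \<in> words n \<Longrightarrow> f w = f' w"
  shows "word_combination f = word_combination f'"
proof -
  have "{w \<in> words n. f w \<noteq> 0} = {w \<in> words n. f' w \<noteq> 0}" using assms by auto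
  thus ?thesis unfolding word_combination_def using assms by (intro finsum_cong') auto
qed

lemma word_combination_add:
  assumes "finite {w \<in> words n. f w \<noteq> 0}" "finite {w \<in> words n. f' w \<noteq> 0}"
  shows "word_combination (\<lambda>w. (f w + f' w) mod int p) = word_combination f \<oplus> word_combination f'"
proof -
  let ?F = "{w \<in> words n. f w \<noteq> 0} \<union> {w \<in> words n. f' w \<noteq> 0}"
  have F: "finite ?F" "?F \<subseteq> words n" using assms by auto
  have "word_combination (\<lambda>w. (f w + f' w) mod int p) = (\<Oplus>w\<in>?F. [((f w + f' w) mod int p)] \<cdot> img w)"
    by (rule word_combination_superset[OF F]) auto
  also have "\<dots> = (\<Oplus>w\<in>?F. [f w] \<cdot> img w \<oplus> [f' w] \<cdot> img w)"
    using F(2) by (intro finsum_cong') (auto simp: add_pow_mod add.int_pow_mult)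
  also have "\<dots> = (\<Oplus>w\<in>?F. [f w] \<cdot> img w) \<oplus> (\<Oplus>w\<in>?F. [f' w] \<cdot> img w)"
    using F(2) by (intro finsum_addf) auto
  also have "\<dots> = word_combination f \<oplus> word_combination f'"
    using word_combination_superset[OF F, of f] word_combination_superset[OF F, of f'] by simp
  finally show ?thesis .
qed

lemma word_combination_closed: "word_combination f \<in> carrier R"
  unfolding word_combination_def by (rule finsum_closed) auto

lemma span_words_combination:
  assumes V: "V \<subseteq> words n" and x: "x \<in> add_span (img ` V)"
  shows "\<exists>f. range f \<subseteq> {0..<int p} \<and> finite {w. f w \<noteq> 0} \<and> {w. f w \<noteq> 0} \<subseteq> V \<and> word_combination f = x"
proof -
  define good where "good = (\<lambda>f. range f \<subseteq> {0..<int p} \<and> finite {w. f w \<noteq> (0::int)} \<and> {w. f w \<noteq> 0} \<subseteq> V)"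
  have p: "int p > 1" using prime_gt_1_nat[OF prime_p] by simp
  have fin: "finite {w \<in> words n. f w \<noteq> 0}" if "good f" for f
    by (rule finite_subset[of _ "{w. f w \<noteq> 0}"]) (use that in \<open>auto simp: good_def\<close>)
  have good_add: "good (\<lambda>w. (f w + f' w) mod int p)" if "good f" "good f'" for f f'
  proof -
    have "{w. (f w + f' w) mod int p \<noteq> 0} \<subseteq> {w. f w \<noteq> 0} \<union> {w. f' w \<noteq> 0}" by auto
    moreover have "finite ({w. f w \<noteq> 0} \<union> {w. f' w \<noteq> 0})" using that by (auto simp: good_def)
    moreover have "{w. f w \<noteq> 0} \<union> {w. f' w \<noteq> 0} \<subseteq> V" using that by (auto simp: good_def)
    moreover have "range (\<lambda>w. (f w + f' w) mod int p) \<subseteq> {0..<int p}" using p by auto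
    ultimately show ?thesis unfolding good_def by (meson finite_subset subset_trans)
  qed
  have zero: "good (\<lambda>_. 0)" "word_combination (\<lambda>_. 0) = \<zero>"
    using p by (auto simp: good_def word_combination_def)
  have good_neg: "good (\<lambda>w. (- f w) mod int p)" if "good f" for f
  proof -
    have "{w. (- f w) mod int p \<noteq> 0} \<subseteq> {w. f w \<noteq> 0}" by auto
    thus ?thesis using that p unfolding good_def by (auto intro: finite_subset)
  qed
  have "x \<in> {x \<in> carrier R. \<exists>f. good f \<and> word_combination f = x}" (is "_ \<in> ?H")
  proof (rule add_span_leastD[OF x])
    show "additive_subgroup ?H R"
    proof (rule additive_subgroup_intro)
      show "\<zero> \<in> ?H" using zero by auto
      fix y assume "y \<in> ?H"
      then obtain f where f: "good f" "word_combination f = y" "y \<in> carrier R" by auto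
      let ?g = "\<lambda>w. (- f w) mod int p"
      have "word_combination ?g \<oplus> y = word_combination (\<lambda>w. (?g w + f w) mod int p)"
        using f fin[OF f(1)] fin[OF good_neg[OF f(1)]] by (simp only: word_combination_add)
      also have "(\<lambda>w. (?g w + f w) mod int p) = (\<lambda>_. 0)" by (simp add: mod_simps)
      finally have "\<ominus> y = word_combination ?g"
        using zero f(3) word_combination_closed by (intro minus_equality) auto
      thus "\<ominus> y \<in> ?H" using good_neg[OF f(1)] word_combination_closed by auto
      fix z assume "z \<in> ?H"
      then obtain f' where f': "good f'" "word_combination f' = z" "z \<in> carrier R" by auto
      have "word_combination (\<lambda>w. (f w + f' w) mod int p) = y \<oplus> z"
        using f f' by (simp add: word_combination_add fin)
      thus "y \<oplus> z \<in> ?H" using good_add[OF f(1) f'(1)] f(3) f'(3) by auto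
    qed auto
    fix s assume "s \<in> img ` V"
    then obtain v where v: "v \<in> V" "s = img v" by blast
    let ?f = "\<lambda>w. if w = v then 1 else (0::int)"
    have "good ?f" using v p by (auto simp: good_def)
    moreover have "{w \<in> words n. ?f w \<noteq> 0} = {v}" using v V by auto
    hence "word_combination ?f = s" unfolding word_combination_def
      using v V by (auto simp: add_pow_int_ge)
    moreover have "s \<in> carrier R" using v V by auto
    ultimately show "s \<in> ?H" by auto
  qed
  then obtain f where "good f" "word_combination f = x" by auto
  thus ?thesis by (intro exI[of _ f]) (simp add: good_def)
qed

text \<open>The coefficient of the leading word is invertible modulo \<open>p\<close>, so a relation with leading word
  \<open>w\<close> can be solved for the image of \<open>w\<close>; conversely \<open>w\<close> minus a combination of smaller words is
  such a relation.\<close>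

theorem reducible_iff_leading_word:
  assumes w: "w \<in> words n"
  shows "reducible w \<longleftrightarrow> (\<exists>f. (\<forall>v\<in>words n. f v \<in> {0..<int p}) \<and> finite {v \<in> words n. f v \<noteq> 0}
    \<and> word_combination f = \<zero> \<and> f w \<noteq> 0 \<and> (\<forall>v\<in>words n. f v \<noteq> 0 \<longrightarrow> jennings_le R a v w))"
proof
  assume "reducible w"
  hence "\<ominus> img w \<in> span_below w"
    unfolding reducible_def by (intro additive_subgroup.a_inv_closed[OF span_below_subgroup]) simp
  then obtain f where f: "range f \<subseteq> {0..<int p}" "finite {v. f v \<noteq> 0}"
      "{v. f v \<noteq> 0} \<subseteq> {v \<in> words n. smaller v w}" "word_combination f = \<ominus> img w"
    using span_words_combination[of "{v \<in> words n. smaller v w}"] unfolding span_below_def by blast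
  let ?F = "{v. f v \<noteq> 0}"
  have wF: "w \<notin> ?F" using f(3) jennings_less_irrefl by blast
  have F: "?F \<subseteq> words n" using f(3) by blast
  \<comment> \<open>The relation \<open>w + f\<close>; the word \<open>w\<close> does not occur in \<open>f\<close>.\<close>
  define f1 where "f1 = f(w := 1)"
  have f1: "f1 w = 1" "\<And>v. v \<noteq> w \<Longrightarrow> f1 v = f v" by (simp_all add: f1_def)
  have fF: "f1 v = f v" if "v \<in> ?F" for v using that wF by (cases "v = w") (simp_all add: f1_def)
  have "word_combination f1 = (\<Oplus>v\<in>insert w ?F. [f1 v] \<cdot> img v)"
    using f(2) F w f1 by (intro word_combination_superset) auto
  also have "\<dots> = img w \<oplus> (\<Oplus>v\<in>?F. [f1 v] \<cdot> img v)"
    using f(2) F w wF f1(1) by (subst finsum_insert) (auto simp: add_pow_int_ge)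
  also have "(\<Oplus>v\<in>?F. [f1 v] \<cdot> img v) = (\<Oplus>v\<in>?F. [f v] \<cdot> img v)"
    using F fF by (intro finsum_cong') auto
  also have "\<dots> = word_combination f"
    using f(2) F by (intro word_combination_superset[symmetric]) auto
  finally have "word_combination f1 = \<zero>" using f(4) w by (simp add: r_neg)
  moreover have "finite {v \<in> words n. f1 v \<noteq> 0}"
    by (rule finite_subset[of _ "insert w ?F"]) (use f(2) f1(2) in \<open>auto\<close>)
  moreover have "\<forall>v\<in>words n. f1 v \<in> {0..<int p}"
  proof
    fix v
    have "f v \<in> {0..<int p}" using f(1) by blast
    thus "f1 v \<in> {0..<int p}" using prime_gt_1_nat[OF prime_p] by (simp add: f1_def)
  qed
  moreover have "\<forall>v\<in>words n. f1 v \<noteq> 0 \<longrightarrow> jennings_le R a v w"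
  proof (intro ballI impI)
    fix v assume "f1 v \<noteq> 0"
    hence "v = w \<or> v \<in> ?F" by (cases "v = w") (simp_all add: f1_def)
    thus "jennings_le R a v w" using f(3) by (auto simp: jennings_le_iff_less_or_eq)
  qed
  ultimately show "\<exists>f. (\<forall>v\<in>words n. f v \<in> {0..<int p}) \<and> finite {v \<in> words n. f v \<noteq> 0}
    \<and> word_combination f = \<zero> \<and> f w \<noteq> 0 \<and> (\<forall>v\<in>words n. f v \<noteq> 0 \<longrightarrow> jennings_le R a v w)"
    using f1(1) by (intro exI[of _ f1]) simp
next
  assume "\<exists>f. (\<forall>v\<in>words n. f v \<in> {0..<int p}) \<and> finite {v \<in> words n. f v \<noteq> 0}
    \<and> word_combination f = \<zero> \<and> f w \<noteq> 0 \<and> (\<forall>v\<in>words n. f v \<noteq> 0 \<longrightarrow> jennings_le R a v w)"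
  then obtain f where f: "\<forall>v\<in>words n. f v \<in> {0..<int p}" "finite {v \<in> words n. f v \<noteq> 0}"
    "word_combination f = \<zero>" "f w \<noteq> 0" "\<forall>v\<in>words n. f v \<noteq> 0 \<longrightarrow> jennings_le R a v w" by blast
  let ?F = "{v \<in> words n. f v \<noteq> 0} - {w}"
  have "insert w ?F = {v \<in> words n. f v \<noteq> 0}" using w f(4) by auto
  hence "\<zero> = (\<Oplus>v\<in>insert w ?F. [f v] \<cdot> img v)" using f(3) by (simp add: word_combination_def)
  also have "\<dots> = [f w] \<cdot> img w \<oplus> (\<Oplus>v\<in>?F. [f v] \<cdot> img v)"
    using f(2) w by (subst finsum_insert) auto
  finally have sum0: "[f w] \<cdot> img w \<oplus> (\<Oplus>v\<in>?F. [f v] \<cdot> img v) = \<zero>" by (rule sym)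
  have "(\<Oplus>v\<in>?F. [f v] \<cdot> img v) \<in> carrier R" by (rule finsum_closed) auto
  hence "[f w] \<cdot> img w = \<ominus> (\<Oplus>v\<in>?F. [f v] \<cdot> img v)"
    using w by (intro minus_equality[OF sum0, symmetric]) auto
  moreover have "(\<Oplus>v\<in>?F. [f v] \<cdot> img v) \<in> span_below w"
  proof (rule finsum_in_additive_subgroup[OF span_below_subgroup])
    show "finite ?F" using f(2) by simp
    fix v assume v: "v \<in> ?F"
    hence "jennings_le R a v w" using f(5) by blast
    hence "smaller v w" using v by (simp add: jennings_le_iff_less_or_eq)
    thus "[f v] \<cdot> img v \<in> span_below w"
      using v by (intro additive_subgroup_add_pow[OF span_below_subgroup] img_in_span_below) auto
  qed
  ultimately have mult: "[f w] \<cdot> img w \<in> span_below w"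
    by (simp only: additive_subgroup.a_inv_closed[OF span_below_subgroup])
  have ndvd: "\<not> int p dvd f w"
  proof
    assume "int p dvd f w"
    moreover have "0 \<le> f w" "f w < int p" using f(1) w by auto
    ultimately show False using f(4) zdvd_imp_le[of "int p" "f w"] by linarith
  qed
  have "img w \<in> span_below w"
    by (rule in_additive_subgroup_if_multiple[OF span_below_subgroup img_closed[OF w] ndvd mult])
  thus "reducible w" using w by (simp add: reducible_def)
qed

end

section \<open>The group algebra of a finite group over a prime field\<close>

locale finite_group_mod_p = G: group G
  for G :: "('g, 'd) monoid_scheme" (structure) and p :: nat +
  assumes prime: "Factorial_Ring.prime p" and finite_carrier: "finite (carrier G)"
begin

abbreviation "A \<equiv> group_algebra p G"

lemma p_gt_1: "int p > 1"
  using prime_gt_1_nat[OF prime] by simp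

lemma carrier_prime_field: "carrier (prime_field p) = {0..<int p}"
  by (auto simp: residue_ring_def)

lemma prime_field_simps:
  "\<zero>\<^bsub>prime_field p\<^esub> = 0" "\<one>\<^bsub>prime_field p\<^esub> = 1"
  "x \<oplus>\<^bsub>prime_field p\<^esub> y = (x + y) mod int p" "x \<otimes>\<^bsub>prime_field p\<^esub> y = (x * y) mod int p"
  by (simp_all add: residue_ring_def)

lemma supp_group_algebra: "supp (prime_field p) G f = {x \<in> carrier G. f x \<noteq> 0}"
  by (simp add: supp_def prime_field_simps)

lemma carrier_A: "carrier A = carrier G \<rightarrow>\<^sub>E {0..<int p}"
  unfolding group_algebra_def monoid_algebra_def using finite_carrier
  by (auto simp: carrier_prime_field supp_def)

lemma zero_A: "\<zero>\<^bsub>A\<^esub> = (\<lambda>x\<in>carrier G. 0)"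
  by (simp add: group_algebra_def monoid_algebra_def prime_field_simps)

lemma one_A: "\<one>\<^bsub>A\<^esub> = (\<lambda>x\<in>carrier G. if x = \<one> then 1 else 0)"
  by (simp add: group_algebra_def monoid_algebra_def prime_field_simps cong: if_cong)

lemma add_A: "f \<oplus>\<^bsub>A\<^esub> g = (\<lambda>x\<in>carrier G. (f x + g x) mod int p)"
  by (simp add: group_algebra_def monoid_algebra_def prime_field_simps)

lemma smult_A: "c \<odot>\<^bsub>A\<^esub> f = (\<lambda>x\<in>carrier G. (c * f x) mod int p)"
  by (simp add: group_algebra_def monoid_algebra_def prime_field_simps)

text \<open>Summing over the pairs \<open>(y, y\<^bsup>-1\<^esup> x)\<close> instead of over the supports, and reducing modulo \<open>p\<close> only
  at the end, turns the ring laws into identities between sums of integers.\<close>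

lemma mult_A:
  "f \<otimes>\<^bsub>A\<^esub> g = (\<lambda>x\<in>carrier G. (\<Sum>y\<in>carrier G. f y * g (inv y \<otimes> x)) mod int p)"
proof -
  interpret F: residues "int p" "prime_field p" by unfold_locales (rule p_gt_1)
  show ?thesis
  proof (rule ext)
    fix x
    show "(f \<otimes>\<^bsub>A\<^esub> g) x = (\<lambda>x\<in>carrier G. (\<Sum>y\<in>carrier G. f y * g (inv y \<otimes> x)) mod int p) x"
    proof (cases "x \<in> carrier G")
      case True
      let ?S = "{(y, z) \<in> supp (prime_field p) G f \<times> supp (prime_field p) G g. y \<otimes> z = x}"
      let ?T = "(\<lambda>y. (y, inv y \<otimes> x)) ` carrier G"
      have ST: "?S \<subseteq> ?T"
        using True by (auto simp: supp_group_algebra G.inv_solve_left intro!: image_eqI)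
      have fin: "finite ?S" by (rule finite_subset[OF ST]) (use finite_carrier in simp)
      have "(f \<otimes>\<^bsub>A\<^esub> g) x = finsum (prime_field p) (\<lambda>(y, z). f y \<otimes>\<^bsub>prime_field p\<^esub> g z) ?S"
        using True by (simp add: group_algebra_def monoid_algebra_def)
      also have "(\<lambda>(y, z). f y \<otimes>\<^bsub>prime_field p\<^esub> g z) = (\<lambda>i. (case i of (y, z) \<Rightarrow> f y * g z) mod int p)"
        by (auto simp: prime_field_simps fun_eq_iff)
      also have "finsum (prime_field p) \<dots> ?S = (\<Sum>i\<in>?S. case i of (y, z) \<Rightarrow> f y * g z) mod int p"
        by (rule F.sum_cong[OF fin])
      also have "(\<Sum>i\<in>?S. case i of (y, z) \<Rightarrow> f y * g z) = (\<Sum>i\<in>?T. case i of (y, z) \<Rightarrow> f y * g z)"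
        using ST finite_carrier True
        by (intro sum.mono_neutral_left) (auto simp: supp_group_algebra simp flip: G.m_assoc)
      also have "\<dots> = (\<Sum>y\<in>carrier G. f y * g (inv y \<otimes> x))"
        by (subst sum.reindex) (auto intro: inj_onI)
      finally show ?thesis using True by simp
    qed (simp add: group_algebra_def monoid_algebra_def)
  qed
qed

lemma A_closed: "f \<in> carrier A \<Longrightarrow> x \<in> carrier G \<Longrightarrow> 0 \<le> f x \<and> f x < int p"
  by (auto simp: carrier_A)

lemma A_eqI:
  assumes "f \<in> carrier A" "g \<in> carrier A" "\<And>x. x \<in> carrier G \<Longrightarrow> f x = g x"
  shows "f = g"
  using assms unfolding carrier_A by (rule PiE_ext)

lemma restrict_mod_in_A: "(\<lambda>x\<in>carrier G. h x mod int p) \<in> carrier A"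
  using p_gt_1 by (auto simp: carrier_A)

lemma sum_mod_left: "(\<Sum>i\<in>S. (f i mod m) * g i) mod m = (\<Sum>i\<in>S. f i * g i) mod (m::int)"
  by (subst (1 2) mod_sum_eq[symmetric]) (simp add: mod_simps)

lemma sum_mod_right: "(\<Sum>i\<in>S. g i * (f i mod m)) mod m = (\<Sum>i\<in>S. g i * f i) mod (m::int)"
  by (subst (1 2) mod_sum_eq[symmetric]) (simp add: mod_simps)

lemma translate_sum:
  assumes "w \<in> carrier G"
  shows "(\<Sum>y\<in>carrier G. h (w \<otimes> y)) = (\<Sum>y\<in>carrier G. h y)"
  by (rule sum.reindex_bij_witness[where j = "\<lambda>y. w \<otimes> y" and i = "\<lambda>y. inv w \<otimes> y"])
    (use assms in \<open>auto simp flip: G.m_assoc\<close>)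

text \<open>Both sides are the sum of \<open>f w * g z * h ((w z)\<^bsup>-1\<^esup> x)\<close> over all \<open>w\<close> and \<open>z\<close>; on the left this
  takes the substitution \<open>y = w z\<close>.\<close>

lemma convolution_assoc:
  assumes x: "x \<in> carrier G"
  shows "((f \<otimes>\<^bsub>A\<^esub> g) \<otimes>\<^bsub>A\<^esub> h) x = (f \<otimes>\<^bsub>A\<^esub> (g \<otimes>\<^bsub>A\<^esub> h)) x"
proof -
  have "((f \<otimes>\<^bsub>A\<^esub> g) \<otimes>\<^bsub>A\<^esub> h) x
      = (\<Sum>y\<in>carrier G. ((\<Sum>w\<in>carrier G. f w * g (inv w \<otimes> y)) mod int p) * h (inv y \<otimes> x)) mod int p"
    using x by (simp add: mult_A)
  also have "\<dots> = (\<Sum>y\<in>carrier G. (\<Sum>w\<in>carrier G. f w * g (inv w \<otimes> y)) * h (inv y \<otimes> x)) mod int p"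
    by (rule sum_mod_left)
  also have "(\<Sum>y\<in>carrier G. (\<Sum>w\<in>carrier G. f w * g (inv w \<otimes> y)) * h (inv y \<otimes> x))
      = (\<Sum>w\<in>carrier G. f w * (\<Sum>y\<in>carrier G. g (inv w \<otimes> y) * h (inv y \<otimes> x)))"
    by (subst sum_distrib_right, subst sum.swap) (simp add: sum_distrib_left mult.assoc)
  also have "\<dots> = (\<Sum>w\<in>carrier G. f w * (\<Sum>z\<in>carrier G. g z * h (inv z \<otimes> (inv w \<otimes> x))))"
  proof (rule sum.cong[OF refl])
    fix w assume w: "w \<in> carrier G"
    have "(\<Sum>y\<in>carrier G. g (inv w \<otimes> y) * h (inv y \<otimes> x))
        = (\<Sum>z\<in>carrier G. g (inv w \<otimes> (w \<otimes> z)) * h (inv (w \<otimes> z) \<otimes> x))"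
      by (rule translate_sum[OF w, symmetric])
    also have "\<dots> = (\<Sum>z\<in>carrier G. g z * h (inv z \<otimes> (inv w \<otimes> x)))"
    proof (rule sum.cong[OF refl])
      fix z assume "z \<in> carrier G"
      thus "g (inv w \<otimes> (w \<otimes> z)) * h (inv (w \<otimes> z) \<otimes> x) = g z * h (inv z \<otimes> (inv w \<otimes> x))"
        using w x by (simp add: G.inv_mult_group G.m_assoc) (simp flip: G.m_assoc)
    qed
    finally show "f w * (\<Sum>y\<in>carrier G. g (inv w \<otimes> y) * h (inv y \<otimes> x))
        = f w * (\<Sum>z\<in>carrier G. g z * h (inv z \<otimes> (inv w \<otimes> x)))" by simp
  qed
  also have "\<dots> mod int p
      = (\<Sum>w\<in>carrier G. f w * ((\<Sum>z\<in>carrier G. g z * h (inv z \<otimes> (inv w \<otimes> x))) mod int p)) mod int p"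
    by (rule sum_mod_right[symmetric])
  also have "\<dots> = (f \<otimes>\<^bsub>A\<^esub> (g \<otimes>\<^bsub>A\<^esub> h)) x" using x by (simp add: mult_A)
  finally show ?thesis .
qed

lemma mult_A_closed: "f \<otimes>\<^bsub>A\<^esub> g \<in> carrier A"
  unfolding mult_A by (rule restrict_mod_in_A)

lemma add_A_closed: "f \<oplus>\<^bsub>A\<^esub> g \<in> carrier A"
  unfolding add_A by (rule restrict_mod_in_A)

lemma zero_A_closed: "\<zero>\<^bsub>A\<^esub> \<in> carrier A"
  using p_gt_1 by (auto simp: zero_A carrier_A)

lemma one_A_closed: "\<one>\<^bsub>A\<^esub> \<in> carrier A"
  using p_gt_1 by (auto simp: one_A carrier_A)

lemma ring_A: "ring A"
proof (rule ringI)
  show "abelian_group A"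
  proof (rule abelian_groupI)
    fix f g h assume f: "f \<in> carrier A" and g: "g \<in> carrier A" and h: "h \<in> carrier A"
    show "f \<oplus>\<^bsub>A\<^esub> g \<oplus>\<^bsub>A\<^esub> h = f \<oplus>\<^bsub>A\<^esub> (g \<oplus>\<^bsub>A\<^esub> h)"
      by (rule A_eqI[OF add_A_closed add_A_closed]) (simp add: add_A mod_simps add.assoc)
    show "f \<oplus>\<^bsub>A\<^esub> g = g \<oplus>\<^bsub>A\<^esub> f" by (simp add: add_A add.commute)
  next
    fix f assume f: "f \<in> carrier A"
    show "\<zero>\<^bsub>A\<^esub> \<oplus>\<^bsub>A\<^esub> f = f"
      by (rule A_eqI[OF add_A_closed f]) (use A_closed[OF f] in \<open>simp add: add_A zero_A\<close>)
    have "(\<lambda>x\<in>carrier G. (- f x) mod int p) \<oplus>\<^bsub>A\<^esub> f = \<zero>\<^bsub>A\<^esub>"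
      by (rule A_eqI[OF add_A_closed zero_A_closed]) (simp add: add_A zero_A mod_simps)
    thus "\<exists>g\<in>carrier A. g \<oplus>\<^bsub>A\<^esub> f = \<zero>\<^bsub>A\<^esub>" by (rule bexI[OF _ restrict_mod_in_A])
  qed (auto intro: add_A_closed zero_A_closed)
  show "Group.monoid A"
  proof (rule monoidI)
    fix f assume f: "f \<in> carrier A"
    show "\<one>\<^bsub>A\<^esub> \<otimes>\<^bsub>A\<^esub> f = f"
    proof (rule A_eqI[OF mult_A_closed f])
      fix x assume x: "x \<in> carrier G"
      have "(\<Sum>y\<in>carrier G. \<one>\<^bsub>A\<^esub> y * f (inv y \<otimes> x)) = (\<Sum>y\<in>carrier G. if y = \<one> then f x else 0)"
        using x by (intro sum.cong) (auto simp: one_A)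
      thus "(\<one>\<^bsub>A\<^esub> \<otimes>\<^bsub>A\<^esub> f) x = f x"
        using x finite_carrier A_closed[OF f x] by (simp add: mult_A)
    qed
    show "f \<otimes>\<^bsub>A\<^esub> \<one>\<^bsub>A\<^esub> = f"
    proof (rule A_eqI[OF mult_A_closed f])
      fix x assume x: "x \<in> carrier G"
      have "(\<Sum>y\<in>carrier G. f y * \<one>\<^bsub>A\<^esub> (inv y \<otimes> x)) = (\<Sum>y\<in>carrier G. if y = x then f x else 0)"
      proof (rule sum.cong[OF refl])
        fix y assume y: "y \<in> carrier G"
        have "inv y \<otimes> x = \<one> \<longleftrightarrow> y = x"
          using x y by (auto simp: G.inv_solve_left')
        thus "f y * \<one>\<^bsub>A\<^esub> (inv y \<otimes> x) = (if y = x then f x else 0)"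
          using x y by (simp add: one_A)
      qed
      thus "(f \<otimes>\<^bsub>A\<^esub> \<one>\<^bsub>A\<^esub>) x = f x"
        using x finite_carrier A_closed[OF f x] by (simp add: mult_A)
    qed
  next
    fix f g h
    show "f \<otimes>\<^bsub>A\<^esub> g \<otimes>\<^bsub>A\<^esub> h = f \<otimes>\<^bsub>A\<^esub> (g \<otimes>\<^bsub>A\<^esub> h)"
      by (rule A_eqI[OF mult_A_closed mult_A_closed convolution_assoc])
  qed (auto intro: mult_A_closed one_A_closed)
next
  fix f g h assume "f \<in> carrier A" "g \<in> carrier A" "h \<in> carrier A"
  show "(f \<oplus>\<^bsub>A\<^esub> g) \<otimes>\<^bsub>A\<^esub> h = f \<otimes>\<^bsub>A\<^esub> h \<oplus>\<^bsub>A\<^esub> g \<otimes>\<^bsub>A\<^esub> h"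
    by (rule A_eqI[OF mult_A_closed add_A_closed])
      (simp add: mult_A add_A sum_mod_left mod_add_eq distrib_right sum.distrib)
  show "h \<otimes>\<^bsub>A\<^esub> (f \<oplus>\<^bsub>A\<^esub> g) = h \<otimes>\<^bsub>A\<^esub> f \<oplus>\<^bsub>A\<^esub> h \<otimes>\<^bsub>A\<^esub> g"
  proof (rule A_eqI[OF mult_A_closed add_A_closed])
    fix x assume x: "x \<in> carrier G"
    have "(\<Sum>y\<in>carrier G. h y * (f \<oplus>\<^bsub>A\<^esub> g) (inv y \<otimes> x))
        = (\<Sum>y\<in>carrier G. h y * ((f (inv y \<otimes> x) + g (inv y \<otimes> x)) mod int p))"
      using x by (intro sum.cong) (auto simp: add_A)
    thus "(h \<otimes>\<^bsub>A\<^esub> (f \<oplus>\<^bsub>A\<^esub> g)) x = (h \<otimes>\<^bsub>A\<^esub> f \<oplus>\<^bsub>A\<^esub> h \<otimes>\<^bsub>A\<^esub> g) x"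
      using x by (simp add: mult_A add_A sum_mod_right mod_add_eq distrib_left sum.distrib)
  qed
qed

sublocale A: ring A
  by (rule ring_A)

lemma card_A: "card (carrier A) = p ^ card (carrier G)"
  using finite_carrier by (simp add: carrier_A card_PiE)

lemma add_pow_A:
  assumes f: "f \<in> carrier A"
  shows "[(k::nat)] \<cdot>\<^bsub>A\<^esub> f = (\<lambda>x\<in>carrier G. (int k * f x) mod int p)"
proof (induction k)
  case 0
  show ?case by (simp add: zero_A)
next
  case (Suc k)
  have "[Suc k] \<cdot>\<^bsub>A\<^esub> f = [k] \<cdot>\<^bsub>A\<^esub> f \<oplus>\<^bsub>A\<^esub> f" using f by simp
  also have "\<dots> = (\<lambda>x\<in>carrier G. (int (Suc k) * f x) mod int p)"
    unfolding Suc add_A by (rule restrict_ext) (simp add: mod_simps algebra_simps)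
  finally show ?case .
qed

lemma char_A: "f \<in> carrier A \<Longrightarrow> [p] \<cdot>\<^bsub>A\<^esub> f = \<zero>\<^bsub>A\<^esub>"
  by (simp add: add_pow_A zero_A)

lemma smult_A_eq_add_pow:
  assumes "f \<in> carrier A" "0 \<le> c"
  shows "c \<odot>\<^bsub>A\<^esub> f = [c] \<cdot>\<^bsub>A\<^esub> f"
  using assms by (simp add: add_pow_int_ge add_pow_A smult_A)

lemma group_elem_eq: "group_elem p G g = (\<lambda>x\<in>carrier G. if x = g then 1 else 0)"
  by (simp add: group_elem_def basis_elem_def prime_field_simps cong: if_cong)

lemma group_elem_closed: "group_elem p G g \<in> carrier A"
  using p_gt_1 by (auto simp: group_elem_eq carrier_A)

lemma group_elem_mult:
  assumes g: "g \<in> carrier G" and h: "h \<in> carrier G"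
  shows "group_elem p G (g \<otimes> h) = group_elem p G g \<otimes>\<^bsub>A\<^esub> group_elem p G h"
proof (rule A_eqI[OF group_elem_closed mult_A_closed])
  fix x assume x: "x \<in> carrier G"
  have "(\<Sum>y\<in>carrier G. group_elem p G g y * group_elem p G h (inv y \<otimes> x))
      = (\<Sum>y\<in>carrier G. if y = g then (if inv g \<otimes> x = h then 1 else 0) else 0)"
    using x by (intro sum.cong) (auto simp: group_elem_eq)
  also have "\<dots> = (if x = g \<otimes> h then 1 else 0)"
    using finite_carrier g h x by (auto simp: G.inv_solve_left' simp flip: G.m_assoc)
  finally show "group_elem p G (g \<otimes> h) x = (group_elem p G g \<otimes>\<^bsub>A\<^esub> group_elem p G h) x"
    using x p_gt_1 by (simp add: mult_A group_elem_eq)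
qed

lemma group_elem_one: "group_elem p G \<one> = \<one>\<^bsub>A\<^esub>"
  by (simp add: group_elem_eq one_A)

lemma carrier_subset_span_group_elem: "carrier A \<subseteq> A.add_span (group_elem p G ` carrier G)"
proof
  let ?H = "A.add_span (group_elem p G ` carrier G)"
  have sub: "additive_subgroup ?H A"
    by (rule A.additive_subgroup_add_span) (use group_elem_closed in blast)
  have "f \<in> carrier A \<Longrightarrow> {x \<in> carrier G. f x \<noteq> 0} \<subseteq> S \<Longrightarrow> f \<in> ?H" if "finite S" for S f
    using that
  proof (induction S arbitrary: f)
    case empty
    have "f = \<zero>\<^bsub>A\<^esub>"
      by (rule A_eqI[OF empty(1) zero_A_closed]) (use empty in \<open>auto simp: zero_A\<close>)
    thus ?case by (simp add: A.zero_in_add_span)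
  next
    case (insert g S)
    show ?case
    proof (cases "g \<in> carrier G")
      case False
      thus ?thesis using insert by blast
    next
      case True
      \<comment> \<open>Split off the term of \<open>g\<close>.\<close>
      let ?f = "f(g := 0)" and ?c = "nat (f g)"
      have c: "0 \<le> f g" "f g < int p" using A_closed[OF insert.prems(1) True] by auto
      have f: "?f \<in> carrier A" using insert.prems(1) True p_gt_1 by (auto simp: carrier_A PiE_iff extensional_def)
      have "f = ?f \<oplus>\<^bsub>A\<^esub> [?c] \<cdot>\<^bsub>A\<^esub> group_elem p G g"
      proof (rule A_eqI[OF insert.prems(1) add_A_closed])
        fix x assume x: "x \<in> carrier G"
        show "f x = (?f \<oplus>\<^bsub>A\<^esub> [?c] \<cdot>\<^bsub>A\<^esub> group_elem p G g) x"
          unfolding add_pow_A[OF group_elem_closed] add_A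
          using x c A_closed[OF insert.prems(1) x] by (simp add: group_elem_eq)
      qed
      moreover have "?f \<in> ?H" using insert.prems(2) by (intro insert.IH[OF f]) auto
      moreover have "[?c] \<cdot>\<^bsub>A\<^esub> group_elem p G g \<in> ?H"
        using True by (intro A.additive_subgroup_add_pow_nat[OF sub] A.add_span_incl) blast
      ultimately show ?thesis using additive_subgroup.a_closed[OF sub] by metis
    qed
  qed
  thus "f \<in> ?H" if "f \<in> carrier A" for f using that finite_carrier by blast
qed

end

section \<open>Tips of the relation ideal\<close>

context finite_group_mod_p
begin

lemma p_group_algebra_A:
  assumes "order G = p ^ n"
  shows "p_group_algebra A G p n (group_elem p G)"
proof -
  have "card (carrier A) = p ^ p ^ n" using assms by (simp add: card_A order_def)
  thus ?thesis
    using prime finite_carrier assms group_elem_closed group_elem_mult group_elem_one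
      carrier_subset_span_group_elem char_A
    by unfold_locales auto
qed

lemma supp_free_word_monoid:
  "supp (prime_field p) (free_word_monoid n) f = {w \<in> words n. f w \<noteq> 0}"
  by (simp add: supp_def free_word_monoid_def prime_field_simps)

lemma carrier_free_algebra:
  "carrier (free_algebra p n) = {f \<in> words n \<rightarrow>\<^sub>E {0..<int p}. finite {w \<in> words n. f w \<noteq> 0}}"
  by (simp add: free_algebra_def monoid_algebra_def supp_free_word_monoid carrier_prime_field)
    (simp add: free_word_monoid_def)

lemma zero_free_algebra: "\<zero>\<^bsub>free_algebra p n\<^esub> = (\<lambda>w\<in>words n. 0)"
  by (simp add: free_algebra_def monoid_algebra_def free_word_monoid_def prime_field_simps)

lemma jennings_family_A:
  assumes ord: "order G = p ^ n" and a: "jennings_generators p G n a"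
  shows "\<exists>g m. jennings_family A G p n (group_elem p G) g m a"
proof -
  interpret p_group_algebra A G p n "group_elem p G" by (rule p_group_algebra_A[OF ord])
  have D: "dimension_subgroup p G r = dim_subgroup r" for r
    by (simp add: dimension_subgroup_def dim_subgroup_def diff_one_def)
  obtain g where g: "jennings_pc_generators p G n g"
    and ag: "\<forall>i\<in>{1..n}. a i = group_elem p G (g i) \<ominus>\<^bsub>A\<^esub> \<one>\<^bsub>A\<^esub>"
    using a unfolding jennings_generators_def by blast
  obtain m where m: "{1..n} = (\<Union>r\<in>{1..}. block m r)"
    "\<forall>r\<ge>1. g ` block m r \<subseteq> dimension_subgroup p G r \<and>
       minimal_generating_family (dimension_quotient p G r)
         (\<lambda>i. dimension_subgroup p G (Suc r) #> g i) (block m r)"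
    using g unfolding jennings_pc_generators_def by blast
  have "jennings_family A G p n (group_elem p G) g m a"
  proof
    show "{1..n} = (\<Union>r\<in>{1..}. block m r)" by (rule m(1))
    fix r :: nat assume r: "1 \<le> r"
    show "g ` block m r \<subseteq> dim_subgroup r" using m(2) r by (simp add: D)
    show "minimal_generating_family (G\<lparr>carrier := dim_subgroup r\<rparr> Mod dim_subgroup (Suc r))
        (\<lambda>i. dim_subgroup (Suc r) #> g i) (block m r)"
      using m(2) r by (simp add: D dimension_quotient_def)
  next
    show "a i = diff_one (g i)" if "i \<in> {1..n}" for i using ag that by (simp add: diff_one_def)
  qed
  thus ?thesis by blast
qed

text \<open>Scalars act as integer multiples, so the natural surjection sends the element with
  coefficients \<open>f\<close> to the combination of word images with these coefficients.\<close>

lemma tip_iff_reducible: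
  assumes fam: "jennings_family A G p n (group_elem p G) g m a"
  shows "tip p G n a w \<longleftrightarrow> jennings_family.reducible A n a w"
proof -
  interpret jennings_family A G p n "group_elem p G" g m a by (rule fam)
  have surj: "natural_surjection p G n a f = word_combination f" if "f \<in> carrier (free_algebra p n)" for f
    unfolding natural_surjection_def word_combination_def supp_free_word_monoid
  proof (rule A.finsum_cong'[OF refl])
    fix v assume "v \<in> {w \<in> words n. f w \<noteq> 0}"
    moreover from this have "0 \<le> f v" using that by (auto simp: carrier_free_algebra)
    ultimately show "f v \<odot>\<^bsub>A\<^esub> img v = [f v] \<cdot>\<^bsub>A\<^esub> img v"
      by (intro smult_A_eq_add_pow) auto
  qed auto
  have relation: "f \<in> relation_ideal p G n a \<longleftrightarrow> f \<in> carrier (free_algebra p n) \<and> word_combination f = \<zero>\<^bsub>A\<^esub>" for f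
    using surj by (auto simp: relation_ideal_def a_kernel_def kernel_def)
  show ?thesis
  proof (cases "w \<in> words n")
    case False
    thus ?thesis by (simp add: tip_def supp_free_word_monoid reducible_def)
  next
    case True
    show ?thesis
      unfolding reducible_iff_leading_word[OF True]
    proof
      assume "tip p G n a w"
      then obtain f where "f \<in> relation_ideal p G n a"
        "w \<in> supp (prime_field p) (free_word_monoid n) f"
        "\<forall>v\<in>supp (prime_field p) (free_word_monoid n) f. jennings_le A a v w"
        unfolding tip_def by blast
      hence f: "f \<in> carrier (free_algebra p n)" "word_combination f = \<zero>\<^bsub>A\<^esub>" "f w \<noteq> 0"
        "\<forall>v\<in>words n. f v \<noteq> 0 \<longrightarrow> jennings_le A a v w"
        unfolding relation supp_free_word_monoid by simp_all
      have "\<forall>v\<in>words n. f v \<in> {0..<int p}" "finite {v \<in> words n. f v \<noteq> 0}"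
        using f(1) unfolding carrier_free_algebra by blast+
      thus "\<exists>f. (\<forall>v\<in>words n. f v \<in> {0..<int p}) \<and> finite {v \<in> words n. f v \<noteq> 0}
        \<and> word_combination f = \<zero>\<^bsub>A\<^esub> \<and> f w \<noteq> 0 \<and> (\<forall>v\<in>words n. f v \<noteq> 0 \<longrightarrow> jennings_le A a v w)"
        using f(2-4) by (intro exI[of _ f] conjI)
    next
      assume "\<exists>f. (\<forall>v\<in>words n. f v \<in> {0..<int p}) \<and> finite {v \<in> words n. f v \<noteq> 0}
        \<and> word_combination f = \<zero>\<^bsub>A\<^esub> \<and> f w \<noteq> 0 \<and> (\<forall>v\<in>words n. f v \<noteq> 0 \<longrightarrow> jennings_le A a v w)"
      then obtain f where f: "\<forall>v\<in>words n. f v \<in> {0..<int p}" "finite {v \<in> words n. f v \<noteq> 0}"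
        "word_combination f = \<zero>\<^bsub>A\<^esub>" "f w \<noteq> 0" "\<forall>v\<in>words n. f v \<noteq> 0 \<longrightarrow> jennings_le A a v w" by blast
      \<comment> \<open>Elements of the free algebra are undefined off the words.\<close>
      define f' where "f' = restrict f (words n)"
      have f': "f' v = f v" if "v \<in> words n" for v using that by (simp add: f'_def)
      have supp: "{v \<in> words n. f' v \<noteq> 0} = {v \<in> words n. f v \<noteq> 0}" using f' by auto
      have "f' \<in> carrier (free_algebra p n)"
        using f(1,2) by (simp add: carrier_free_algebra supp) (simp add: f'_def)
      moreover have "word_combination f' = \<zero>\<^bsub>A\<^esub>"
        using word_combination_cong[of f' f] f' f(3) by simp
      ultimately have "f' \<in> relation_ideal p G n a" by (simp add: relation)
      moreover have "f' \<noteq> \<zero>\<^bsub>free_algebra p n\<^esub>"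
        using f(4) f'[OF True] True by (auto simp: zero_free_algebra)
      moreover have "w \<in> supp (prime_field p) (free_word_monoid n) f'"
        using True f(4) by (simp add: supp_free_word_monoid f')
      moreover have "\<forall>v\<in>supp (prime_field p) (free_word_monoid n) f'. jennings_le A a v w"
        unfolding supp_free_word_monoid supp using f(5) by blast
      ultimately show "tip p G n a w" unfolding tip_def by blast
    qed
  qed
qed

end

theorem proposition3p6:
  fixes p n :: nat
    and G :: "('g, 'd) monoid_scheme"
    and a :: "nat \<Rightarrow> 'g \<Rightarrow> int"
  assumes "Factorial_Ring.prime p"
    and "group G"
    and "finite (carrier G)"
    and "order G = p ^ n"
    and "jennings_generators p G n a"
  shows "({w. minimal_tip p G n a w} =
           {replicate p i | i. i \<in> {1..n}} \<union> {[j, k] | j k. 1 \<le> j \<and> j < k \<and> k \<le> n})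
    \<and> ({w. nontip p G n a w} =
           {descending_word n e | e. \<forall>i\<in>{1..n}. e i \<le> p - 1})
    \<and> (\<forall>w r. nontip p G n a w \<longrightarrow>
           (word_image (group_algebra p G) a w
              \<in> rad_power (group_algebra p G) r - rad_power (group_algebra p G) (Suc r)
            \<longleftrightarrow> word_dim (group_algebra p G) a w = r))"
proof -
  interpret finite_group_mod_p G p
    using assms(1-3) by (simp add: finite_group_mod_p_def finite_group_mod_p_axioms_def)
  obtain g m where fam: "jennings_family A G p n (group_elem p G) g m a"
    using jennings_family_A[OF assms(4,5)] by blast
  interpret jennings_family A G p n "group_elem p G" g m a by (rule fam)
  note tip = tip_iff_reducible[OF fam]
  have nontip: "nontip p G n a w \<longleftrightarrow> w \<in> nwords" for w
    using reducible_iff[of w] normal_words_subset[of p n] by (auto simp: nontip_def tip)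
  have minimal: "minimal_tip p G n a w \<longleftrightarrow>
      (\<exists>i\<in>{1..n}. w = replicate p i) \<or> (\<exists>j k. 1 \<le> j \<and> j < k \<and> k \<le> n \<and> w = [j, k])" for w
    unfolding minimal_tip_def tip nontip by (rule minimal_reducible_iff)
  show ?thesis
  proof (intro conjI allI impI)
    show "{w. minimal_tip p G n a w} =
        {replicate p i | i. i \<in> {1..n}} \<union> {[j, k] | j k. 1 \<le> j \<and> j < k \<and> k \<le> n}"
      unfolding minimal by blast
    show "{w. nontip p G n a w} = {descending_word n e | e. \<forall>i\<in>{1..n}. e i \<le> p - 1}"
      unfolding nontip normal_words_def by blast
    fix w r assume "nontip p G n a w"
    thus "img w \<in> P r - P (Suc r) \<longleftrightarrow> wdim w = r"
      unfolding nontip by (rule normal_word_exact_power)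
  qed
qed

end
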